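(* Let $(x^k)_{k\in\mathbb{N}}$ be the sequence generated by Method 1. Suppose that $S_*\neq\emptyset$. (i) If $\nabla f$ is globally Lipschitz continuous on $\operatorname{dom}g$, then $(f+g)(x^k)-\min_{x\in\mathcal{H}}(f+g)(x)=\mathcal{O}(k^{-1})$ as $k\to\infty$. (ii) If $\dim\mathcal{H}<+\infty$ and $\nabla f$ is locally Lipschitz continuous on $S_*$, then $(f+g)(x^k)-\min_{x\in\mathcal{H}}(f+g)(x)=o(k^{-1})$ as $k\to\infty$.
   Context: Let $\mathcal{H}$ be a real Hilbert space with inner product $\langle\cdot,\cdot\rangle$ and induced norm $\|\cdot\|$; $\overline{\mathbb{R}}:=\mathbb{R}\cup\{+\infty\}$ and $\operatorname{dom}h:=\{x\in\mathcal{H}: h(x)<+\infty\}$. Standing assumptions. (A1) $f,g:\mathcal{H}\to\overline{\mathbb{R}}$ are proper lower semicontinuous convex functions with $\operatorname{dom}g\subseteq\operatorname{dom}f$. (A2) $f$ is Fréchet differentiable on an open set containing $\operatorname{dom}g$; its gradient $\nabla f$ is uniformly continuous on any bounded subset of $\operatorname{dom}g$ and maps any bounded subset of $\operatorname{dom}g$ to a bounded set in $\mathcal{H}$. $S_*$ denotes the set of minimizers of $f+g$ over $\mathcal{H}$. "$\nabla f$ is locally Lipschitz continuous on $S_*$" means that for every $x\in S_*$ there are $\varepsilon,\mathcal{L}>0$ with $\|\nabla f(u)-\nabla f(v)\|\le\mathcal{L}\|u-v\|$ for all $u,v$ in the closed ball $\mathbb{B}_\varepsilon(x)$ of center $x$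 and radius $\varepsilon$. The proximal operator is $\operatorname{prox}_{\alpha g}:=(\mathrm{Id}+\alpha\,\partial g)^{-1}$, which is single-valued and defined on all of $\mathcal{H}$ with values in $\operatorname{dom}g$. For $x\in\operatorname{dom}g$ and $\alpha>0$, $J(x,\alpha):=\operatorname{prox}_{\alpha g}(x-\alpha\nabla f(x))$. Linesearch 1 $(x,\sigma,\theta,\delta)$, for $x\in\operatorname{dom}g$, $\sigma>0$, $\theta\in(0,1)$, $\delta\in(0,1/2)$: set $\alpha=\sigma$; while $\alpha\|\nabla f(J(x,\alpha))-\nabla f(x)\|>\delta\|J(x,\alpha)-x\|$, replace $\alpha$ by $\theta\alpha$; output $\alpha$. Method 1: choose $x^0\in\operatorname{dom}g$, $\sigma>0$, $\theta\in(0,1)$, $\delta\in(0,1/2)$. For $k=0,1,2,\dots$ let $\alpha_k$ be the output of Linesearch 1 $(x^k,\sigma,\theta,\delta)$ and set $x^{k+1}=J(x^k,\alpha_k)$; the stop criterion is $x^{k+1}=x^k$. The statement concerns the infinite sequence $(x^k)_{k\in\mathbb{N}}$ so generated. *)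

theory Defs
  imports
    "HOL-Analysis.Analysis"
    "HOL-Library.Landau_Symbols"
    "HOL-Library.While_Combinator"
begin

definition edom :: "('a \<Rightarrow> ereal) \<Rightarrow> 'a set" where
  "edom h = {x. h x < \<infinity>}"

text \<open>The value \<open>-\<infinity>\<close>, which \<open>ereal\<close> admits, is excluded by properness.\<close>

definition proper_fun :: "('a \<Rightarrow> ereal) \<Rightarrow> bool" where
  "proper_fun h \<longleftrightarrow> (\<forall>x. h x \<noteq> -\<infinity>) \<and> edom h \<noteq> {}"

definition lsc_fun :: "('a::topological_space \<Rightarrow> ereal) \<Rightarrow> bool" where
  "lsc_fun h \<longleftrightarrow> (\<forall>x. h x \<le> Liminf (at x) h)"

definition convex_fun :: "('a::real_vector \<Rightarrow> ereal) \<Rightarrow> bool" where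
  "convex_fun h \<longleftrightarrow> (\<forall>x y. \<forall>t. 0 < t \<and> t < 1 \<longrightarrow>
     h ((1 - t) *\<^sub>R x + t *\<^sub>R y) \<le> ereal (1 - t) * h x + ereal t * h y)"

text \<open>Finiteness near \<open>x\<close> is required because \<open>real_of_ereal\<close> sends infinite values to \<open>0\<close>.\<close>

definition frechet_differentiable_at ::
    "('a::real_normed_vector \<Rightarrow> ereal) \<Rightarrow> 'a \<Rightarrow> bool" where
  "frechet_differentiable_at h x \<longleftrightarrow>
     (\<forall>\<^sub>F y in nhds x. \<bar>h y\<bar> \<noteq> \<infinity>) \<and> (\<lambda>y. real_of_ereal (h y)) differentiable (at x)"

text \<open>Meaningful only at points of Frechet differentiability.\<close>

definition grad :: "('a::real_inner \<Rightarrow> ereal) \<Rightarrow> 'a \<Rightarrow> 'a" where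
  "grad h x = (THE D. GDERIV (\<lambda>y. real_of_ereal (h y)) x :> D)"

definition assumption_A1 ::
    "('a::real_inner \<Rightarrow> ereal) \<Rightarrow> ('a \<Rightarrow> ereal) \<Rightarrow> bool" where
  "assumption_A1 f g \<longleftrightarrow>
     proper_fun f \<and> lsc_fun f \<and> convex_fun f \<and>
     proper_fun g \<and> lsc_fun g \<and> convex_fun g \<and> edom g \<subseteq> edom f"

definition assumption_A2 ::
    "('a::real_inner \<Rightarrow> ereal) \<Rightarrow> ('a \<Rightarrow> ereal) \<Rightarrow> bool" where
  "assumption_A2 f g \<longleftrightarrow>
     (\<exists>U. open U \<and> edom g \<subseteq> U \<and> (\<forall>x\<in>U. frechet_differentiable_at f x)) \<and>
     (\<forall>B. B \<subseteq> edom g \<and> bounded B \<longrightarrow>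
        uniformly_continuous_on B (grad f) \<and> bounded (grad f ` B))"

definition minimizers :: "('a \<Rightarrow> ereal) \<Rightarrow> 'a set" where
  "minimizers h = {x. is_arg_min h (\<lambda>_. True) x}"

definition locally_lipschitz_near ::
    "('a::metric_space \<Rightarrow> 'b::metric_space) \<Rightarrow> 'a set \<Rightarrow> bool" where
  "locally_lipschitz_near F S \<longleftrightarrow>
     (\<forall>x\<in>S. \<exists>\<epsilon>>0. \<exists>L>0. L-lipschitz_on (cball x \<epsilon>) F)"

definition subdifferential :: "('a::real_inner \<Rightarrow> ereal) \<Rightarrow> 'a \<Rightarrow> 'a set" where
  "subdifferential h x = {v. \<forall>y. h x + ereal (v \<bullet> (y - x)) \<le> h y}"

text \<open>The resolvent \<open>(Id + \<alpha> \<partial>g)\<^sup>-\<^sup>1\<close> as a single-valued map: the description operator is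
  justified by Minty's theorem whenever \<open>g\<close> is proper, lower semicontinuous and convex on a
  Hilbert space and \<open>\<alpha> > 0\<close>.\<close>

definition prox :: "real \<Rightarrow> ('a::real_inner \<Rightarrow> ereal) \<Rightarrow> 'a \<Rightarrow> 'a" where
  "prox \<alpha> g y = (THE p. \<exists>v\<in>subdifferential g p. y = p + \<alpha> *\<^sub>R v)"

definition fb_step ::
    "('a::real_inner \<Rightarrow> ereal) \<Rightarrow> ('a \<Rightarrow> ereal) \<Rightarrow> 'a \<Rightarrow> real \<Rightarrow> 'a" where
  "fb_step f g x \<alpha> = prox \<alpha> g (x - \<alpha> *\<^sub>R grad f x)"

text \<open>\<open>while\<close> returns an unspecified value if the loop does not terminate; termination is a
  consequence of the standing assumptions, not a hypothesis.\<close>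

definition linesearch1 ::
    "('a::real_inner \<Rightarrow> ereal) \<Rightarrow> ('a \<Rightarrow> ereal) \<Rightarrow> 'a \<Rightarrow> real \<Rightarrow> real \<Rightarrow> real \<Rightarrow> real" where
  "linesearch1 f g x \<sigma> \<theta> \<delta> =
     while (\<lambda>\<alpha>. \<alpha> * norm (grad f (fb_step f g x \<alpha>) - grad f x) > \<delta> * norm (fb_step f g x \<alpha> - x))
           (\<lambda>\<alpha>. \<theta> * \<alpha>) \<sigma>"

text \<open>If the stop criterion \<open>x\<^sup>k\<^sup>+\<^sup>1 = x\<^sup>k\<close> is ever met, the recursion continues the sequence
  constantly.\<close>

primrec method1 ::
    "('a::real_inner \<Rightarrow> ereal) \<Rightarrow> ('a \<Rightarrow> ereal) \<Rightarrow> real \<Rightarrow> real \<Rightarrow> real \<Rightarrow> 'a \<Rightarrow> nat \<Rightarrow> 'a" where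
  "method1 f g \<sigma> \<theta> \<delta> x0 0 = x0"
| "method1 f g \<sigma> \<theta> \<delta> x0 (Suc k) =
     fb_step f g (method1 f g \<sigma> \<theta> \<delta> x0 k) (linesearch1 f g (method1 f g \<sigma> \<theta> \<delta> x0 k) \<sigma> \<theta> \<delta>)"

text \<open>When \<open>h\<close> has a minimizer the infimum is the minimum. The difference is finite for
  \<open>h = f + g\<close> at every iterate, because the iterates stay in \<open>edom g\<close>.\<close>

definition objective_gap :: "('a \<Rightarrow> ereal) \<Rightarrow> 'a \<Rightarrow> real" where
  "objective_gap h x = real_of_ereal (h x - (INF y. h y))"

end

theory Submission
  imports Defs
begin

text \<open>
  An accepted step from \<open>x\<^sup>k\<close> with step size \<open>\<alpha>\<^sub>k\<close> satisfies, for every \<open>u\<close> in the domain of \<open>g\<close>,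
  \<open>2 \<alpha>\<^sub>k ((f + g) x\<^sup>k\<^sup>+\<^sup>1 - (f + g) u) + (1 - 2 \<delta>) \<parallel>x\<^sup>k - x\<^sup>k\<^sup>+\<^sup>1\<parallel>\<^sup>2 \<le> \<parallel>x\<^sup>k - u\<parallel>\<^sup>2 - \<parallel>x\<^sup>k\<^sup>+\<^sup>1 - u\<parallel>\<^sup>2\<close>.
  Hence the objective gap is decreasing, and its product with the step sizes is summable. Once the
  step sizes are bounded away from \<open>0\<close>, the gap itself is decreasing and summable, so it is
  \<open>o(1/k)\<close>. A Lipschitz constant of the gradient that covers both \<open>x\<^sup>k\<close> and the last rejected trial
  point bounds \<open>\<alpha>\<^sub>k\<close> from below. In part (i) this is immediate, which gives \<open>o(1/k)\<close> there as well. In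
  part (ii) the iterates converge to a minimizer, and the trial points follow them because
  \<open>\<parallel>x - J(x, \<alpha>)\<parallel> / \<alpha>\<close> is nonincreasing in \<open>\<alpha>\<close>.
\<close>

section \<open>Proximal points of lower semicontinuous convex functions\<close>

lemma proper_fun_finite:
  assumes "proper_fun h" "z \<in> edom h"
  shows "h z = ereal (real_of_ereal (h z))"
  using assms by (cases "h z") (auto simp: proper_fun_def edom_def)

lemma edomI: "h z \<le> ereal c \<Longrightarrow> z \<in> edom h"
  by (auto simp: edom_def)

lemma convex_fun_edom:
  assumes h: "proper_fun h" "convex_fun h" and uv: "u \<in> edom h" "v \<in> edom h"
    and t: "0 < t" "t < (1::real)"
  shows "(1 - t) *\<^sub>R u + t *\<^sub>R v \<in> edom h"
    and "real_of_ereal (h ((1 - t) *\<^sub>R u + t *\<^sub>R v))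
      \<le> (1 - t) * real_of_ereal (h u) + t * real_of_ereal (h v)"
proof -
  let ?w = "(1 - t) *\<^sub>R u + t *\<^sub>R v"
  have "h ?w \<le> ereal (1 - t) * h u + ereal t * h v"
    using h(2) t unfolding convex_fun_def by blast
  also have "\<dots> = ereal ((1 - t) * real_of_ereal (h u) + t * real_of_ereal (h v))"
    using proper_fun_finite[OF h(1) uv(1)] proper_fun_finite[OF h(1) uv(2)]
    by (metis plus_ereal.simps(1) times_ereal.simps(1))
  finally have le: "h ?w \<le> ereal ((1 - t) * real_of_ereal (h u) + t * real_of_ereal (h v))" .
  show "?w \<in> edom h"
    using le by (rule edomI)
  then show "real_of_ereal (h ?w) \<le> (1 - t) * real_of_ereal (h u) + t * real_of_ereal (h v)"
    using le proper_fun_finite[OF h(1)] by (metis ereal_less_eq(3))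
qed

lemma lsc_fun_eventually:
  assumes "lsc_fun h" "c < h x"
  shows "\<forall>\<^sub>F y in nhds x. c < h y"
  using assms unfolding lsc_fun_def le_Liminf_iff eventually_nhds_conv_at by blast

lemma lsc_fun_add:
  assumes "lsc_fun f" "lsc_fun g" "proper_fun f" "proper_fun g"
  shows "lsc_fun (\<lambda>x. f x + g x)"
  unfolding lsc_fun_def le_Liminf_iff
proof (intro allI impI)
  fix x c assume c: "c < f x + g x"
  have nf: "f x \<noteq> -\<infinity>" "g x \<noteq> -\<infinity>"
    using assms by (auto simp: proper_fun_def)
  obtain a b where ab: "a < f x" "b < g x" "c \<le> a + b"
  proof -
    obtain c' where c': "c < ereal c'" "ereal c' < f x + g x"
      using ereal_dense2[OF c] by blast
    have "\<exists>a b. a < f x \<and> b < g x \<and> ereal c' \<le> a + b"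
    proof (cases "f x")
      case (real r)
      then have "ereal (c' - r) < g x"
        using c'(2) by (cases "g x") auto
      then obtain d where d: "ereal (c' - r) < ereal d" "ereal d < g x"
        using ereal_dense2 by blast
      \<comment> \<open>The slack of \<open>d\<close> over \<open>c' - r\<close> is taken away from
        \<open>r\<close>: the threshold for \<open>f\<close> becomes strict, and both thresholds
        still add up to \<open>c'\<close>.\<close>
      have "ereal (r - (d - (c' - r))) < f x" "ereal c' \<le> ereal (r - (d - (c' - r))) + ereal d"
        using real d by auto
      then show ?thesis using d by blast
    next
      case PInf
      obtain b where b: "ereal b < g x"
        using nf(2) by (metis ereal_MInfty_lessI ereal_dense2)
      have "ereal (c' - b) < f x" "ereal c' \<le> ereal (c' - b) + ereal b"
        using PInf by auto
      then show ?thesis using b by blast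
    qed (use nf in auto)
    then show ?thesis using that c'(1) by (meson less_imp_le order_trans)
  qed
  have "\<forall>\<^sub>F y in at x. a < f y" "\<forall>\<^sub>F y in at x. b < g y"
    using lsc_fun_eventually[OF assms(1) ab(1)] lsc_fun_eventually[OF assms(2) ab(2)]
    by (auto simp: eventually_nhds_conv_at)
  then show "\<forall>\<^sub>F y in at x. c < f y + g y"
  proof eventually_elim
    case (elim y)
    then show ?case using ab(3) by (meson ereal_add_strict_mono2 le_less_trans)
  qed
qed

text \<open>Points and bounds both vary with n; in this form subgradient inequalities and minimality
  pass to limits. A real number strictly between \<open>l\<close> and \<open>h x\<close> would
  eventually lie below \<open>c n\<close>, hence below \<open>l\<close>.\<close>

lemma lsc_fun_le_limit:
  assumes "lsc_fun h" "z \<longlonglongrightarrow> x" "\<forall>\<^sub>F n in sequentially. h (z n) \<le> ereal (c n)" "c \<longlonglongrightarrow> l"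
  shows "h x \<le> ereal l"
proof (rule ccontr)
  assume "\<not> ?thesis"
  then have "ereal l < h x" by simp
  then obtain a where a: "ereal l < ereal a" "ereal a < h x"
    using ereal_dense2 by blast
  have "\<forall>\<^sub>F n in sequentially. ereal a < h (z n)"
    using lsc_fun_eventually[OF assms(1) a(2)] assms(2) by (rule eventually_compose_filterlim)
  with assms(3) have "\<forall>\<^sub>F n in sequentially. a \<le> c n"
  proof eventually_elim
    case (elim n)
    then have "ereal a < ereal (c n)" by (metis less_le_trans)
    then show ?case by simp
  qed
  then have "a \<le> l"
    using assms(4) by (metis tendsto_lowerbound trivial_limit_sequentially)
  then show False using a by simp
qed

text \<open>Lower semicontinuity bounds \<open>h\<close> below on a small ball around a point of its domain, and
  convexity along rays propagates this bound; no separation theorem is needed.\<close>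

lemma proper_lsc_convex_minorant:
  fixes h :: "'a::real_normed_vector \<Rightarrow> ereal"
  assumes h: "proper_fun h" "lsc_fun h" "convex_fun h"
  shows "\<exists>a b. \<forall>z\<in>edom h. a - b * norm (z - y) \<le> real_of_ereal (h z)"
proof -
  define r where "r z = real_of_ereal (h z)" for z
  have fin: "h z = ereal (r z)" if "z \<in> edom h" for z
    using proper_fun_finite[OF h(1) that] by (simp add: r_def)
  obtain u where u: "u \<in> edom h"
    using h(1) by (auto simp: proper_fun_def)
  have "ereal (r u - 1) < h u"
    using fin[OF u] by simp
  from lsc_fun_eventually[OF h(2) this] obtain e where
    e: "e > 0" "\<And>z. dist z u < e \<Longrightarrow> ereal (r u - 1) < h z"
    by (auto simp: eventually_nhds_metric)
  have bound: "r u - 1 - 2 / e * norm (z - u) \<le> r z" if z: "z \<in> edom h" for z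
  proof (cases "norm (z - u) < e")
    case True
    then have "r u - 1 < r z"
      using e(2)[of z] fin[OF z] by (simp add: dist_norm)
    moreover have "2 / e * norm (z - u) \<ge> 0"
      using e(1) by simp
    ultimately show ?thesis by linarith
  next
    case False
    define n where "n = norm (z - u)"
    \<comment> \<open>This weight puts the point \<open>?w\<close> of the segment at distance
      \<open>e / 2\<close> from \<open>u\<close>, inside the ball where the local bound
      holds.\<close>
    define t where "t = e / (2 * n)"
    have n: "n \<ge> e" using False by (simp add: n_def)
    then have t: "0 < t" "t < 1"
      using e(1) by (auto simp: t_def field_simps)
    let ?w = "(1 - t) *\<^sub>R u + t *\<^sub>R z"
    have "?w - u = t *\<^sub>R (z - u)" by (simp add: algebra_simps)
    then have "norm (?w - u) = t * n" using t by (simp add: n_def)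
    also have "\<dots> < e" using n e(1) by (simp add: t_def)
    finally have "ereal (r u - 1) < h ?w"
      using e(2) by (simp add: dist_norm)
    then have "r u - 1 < r ?w"
      using fin[OF convex_fun_edom(1)[OF h(1,3) u z t]] by simp
    also have "r ?w \<le> (1 - t) * r u + t * r z"
      unfolding r_def by (rule convex_fun_edom(2)[OF h(1,3) u z t])
    finally have "t * (r u - r z) < 1" by (simp add: algebra_simps)
    then have "r u - r z < 1 / t" using t by (simp add: field_simps)
    also have "1 / t = 2 / e * n" using n e(1) by (simp add: t_def)
    finally show ?thesis by (simp add: n_def)
  qed
  have "(r u - 1 - 2 / e * norm (y - u)) - 2 / e * norm (z - y) \<le> real_of_ereal (h z)"
    if z: "z \<in> edom h" for z
  proof -
    have "norm (z - u) \<le> norm (z - y) + norm (y - u)"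
      by (metis dist_norm dist_triangle)
    then have "2 / e * norm (z - u) \<le> 2 / e * norm (z - y) + 2 / e * norm (y - u)"
      using e(1) by (metis distrib_left less_eq_real_def mult_left_mono zero_less_divide_iff zero_less_numeral)
    then show ?thesis using bound[OF z] by (simp add: r_def)
  qed
  then show ?thesis by blast
qed

section \<open>Subgradients and the proximal operator\<close>

lemma subdifferentialI:
  assumes "proper_fun h" "p \<in> edom h"
    and "\<And>z. z \<in> edom h \<Longrightarrow> real_of_ereal (h p) + v \<bullet> (z - p) \<le> real_of_ereal (h z)"
  shows "v \<in> subdifferential h p"
  unfolding subdifferential_def
proof (intro CollectI allI)
  fix z
  show "h p + ereal (v \<bullet> (z - p)) \<le> h z"
  proof (cases "z \<in> edom h")
    case True
    then show ?thesis
      using assms(3)[OF True] proper_fun_finite[OF assms(1,2)] proper_fun_finite[OF assms(1) True]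
      by (metis ereal_less_eq(3) plus_ereal.simps(1))
  next
    case False
    then show ?thesis by (simp add: edom_def)
  qed
qed

lemma subdifferentialD:
  assumes "proper_fun h" "v \<in> subdifferential h p"
  shows "p \<in> edom h"
    and "z \<in> edom h \<Longrightarrow> real_of_ereal (h p) + v \<bullet> (z - p) \<le> real_of_ereal (h z)"
proof -
  have sub: "h p + ereal (v \<bullet> (z - p)) \<le> h z" for z
    using assms(2) by (simp add: subdifferential_def)
  obtain u where u: "u \<in> edom h"
    using assms(1) by (auto simp: proper_fun_def)
  show p: "p \<in> edom h"
    using sub[of u] u by (cases "h p") (auto simp: edom_def)
  show "real_of_ereal (h p) + v \<bullet> (z - p) \<le> real_of_ereal (h z)" if z: "z \<in> edom h"
    using sub[of z] proper_fun_finite[OF assms(1) p] proper_fun_finite[OF assms(1) z]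
    by (metis ereal_less_eq(3) plus_ereal.simps(1))
qed

text \<open>The parallelogram law, with the midpoint in the shape that
  \<open>convex_fun_edom\<close> yields for t = 1/2.\<close>

lemma norm_midpoint_sq:
  fixes u v y :: "'a::real_inner"
  shows "(norm ((1 - 1/2) *\<^sub>R u + (1/2) *\<^sub>R v - y))\<^sup>2
    = ((norm (u - y))\<^sup>2 + (norm (v - y))\<^sup>2) / 2 - (norm (u - v))\<^sup>2 / 4"
  unfolding power2_norm_eq_inner
  by (simp add: inner_commute inner_add_left inner_add_right inner_diff_left inner_diff_right field_simps)

text \<open>A minimizing sequence of \<open>h + \<parallel>\<cdot> - y\<parallel>\<^sup>2 / (2 \<alpha>)\<close> is Cauchy by the parallelogram law.\<close>

lemma prox_point_exists:
  fixes h :: "'a::{real_inner, complete_space} \<Rightarrow> ereal"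
  assumes h: "proper_fun h" "lsc_fun h" "convex_fun h" and \<alpha>: "\<alpha> > 0"
  shows "\<exists>p. \<exists>v\<in>subdifferential h p. y = p + \<alpha> *\<^sub>R v"
proof -
  define r where "r z = real_of_ereal (h z)" for z
  define \<phi> where "\<phi> z = r z + (norm (z - y))\<^sup>2 / (2 * \<alpha>)" for z
  define m where "m = (INF z\<in>edom h. \<phi> z)"
  have ne: "edom h \<noteq> {}" using h(1) by (simp add: proper_fun_def)
  obtain a b where ab: "\<And>z. z \<in> edom h \<Longrightarrow> a - b * norm (z - y) \<le> r z"
    using proper_lsc_convex_minorant[OF h, of y] unfolding r_def by blast
  have "a - b\<^sup>2 * \<alpha> / 2 \<le> \<phi> z" if z: "z \<in> edom h" for z
  proof -
    define n where "n = norm (z - y)"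
    \<comment> \<open>Completing the square: the quadratic term outweighs the linear minorant of
      \<open>h\<close>, so \<open>\<phi>\<close> is bounded below.\<close>
    have "0 \<le> (n - b * \<alpha>)\<^sup>2 / (2 * \<alpha>)" using \<alpha> by simp
    also have "\<dots> = n\<^sup>2 / (2 * \<alpha>) - b * n + b\<^sup>2 * \<alpha> / 2"
      using \<alpha> by (simp add: power2_diff field_simps) (simp add: power2_eq_square)
    finally show ?thesis using ab[OF z] by (simp add: \<phi>_def n_def)
  qed
  then have bdd: "bdd_below (\<phi> ` edom h)" by (auto simp: bdd_below_def)
  have m_le: "m \<le> \<phi> z" if "z \<in> edom h" for z
    unfolding m_def by (rule cINF_lower[OF bdd that])
  have "\<exists>z\<in>edom h. \<phi> z < m + 1 / Suc n" for n
    unfolding m_def using cINF_less_iff[OF ne bdd, of "m + 1 / Suc n"] by (simp add: m_def)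
  then obtain z where z: "\<And>n. z n \<in> edom h" "\<And>n. \<phi> (z n) < m + 1 / Suc n"
    by metis
  have close: "(norm (u - v))\<^sup>2 / (8 * \<alpha>) \<le> (\<phi> u + \<phi> v) / 2 - m" if uv: "u \<in> edom h" "v \<in> edom h" for u v
  proof -
    let ?w = "(1 - 1/2) *\<^sub>R u + (1/2::real) *\<^sub>R v"
    have t: "0 < (1/2::real)" "(1/2::real) < 1" by auto
    have "m \<le> \<phi> ?w"
      by (rule m_le) (rule convex_fun_edom(1)[OF h(1,3) uv t])
    also have "\<phi> ?w \<le> (1 - 1/2) * r u + 1/2 * r v + (norm (?w - y))\<^sup>2 / (2 * \<alpha>)"
      using convex_fun_edom(2)[OF h(1,3) uv t] unfolding \<phi>_def r_def by simp
    also have "\<dots> = (\<phi> u + \<phi> v) / 2 - (norm (u - v))\<^sup>2 / (8 * \<alpha>)"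
      unfolding norm_midpoint_sq \<phi>_def using \<alpha> by (simp add: field_simps)
    finally show ?thesis by simp
  qed
  have "Cauchy z"
  proof (rule metric_CauchyI)
    fix e :: real assume e: "e > 0"
    obtain N where N: "inverse (real (Suc N)) < e\<^sup>2 / (8 * \<alpha>)"
      using reals_Archimedean[of "e\<^sup>2 / (8 * \<alpha>)"] e \<alpha> by auto
    have \<phi>_less: "\<phi> (z i) < m + e\<^sup>2 / (8 * \<alpha>)" if i: "i \<ge> N" for i
    proof -
      have "1 / real (Suc i) \<le> inverse (real (Suc N))"
        using i by (simp add: field_simps)
      then have "1 / real (Suc i) < e\<^sup>2 / (8 * \<alpha>)"
        using N by (rule le_less_trans)
      then show ?thesis
        using z(2)[of i] by (meson add_strict_left_mono less_trans)
    qed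
    have "dist (z i) (z j) < e" if ij: "i \<ge> N" "j \<ge> N" for i j
    proof -
      have "(\<phi> (z i) + \<phi> (z j)) / 2 - m < e\<^sup>2 / (8 * \<alpha>)"
        using \<phi>_less[OF ij(1)] \<phi>_less[OF ij(2)] by (simp add: field_simps)
      with close[OF z(1) z(1), of i j] have "(norm (z i - z j))\<^sup>2 / (8 * \<alpha>) < e\<^sup>2 / (8 * \<alpha>)" by linarith
      then have "(norm (z i - z j))\<^sup>2 < e\<^sup>2" using \<alpha> by (simp add: divide_less_cancel)
      then show ?thesis using e by (simp add: dist_norm power2_less_imp_less)
    qed
    then show "\<exists>N. \<forall>i\<ge>N. \<forall>j\<ge>N. dist (z i) (z j) < e" by blast
  qed
  then obtain p where p: "z \<longlonglongrightarrow> p"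
    by (auto simp: Cauchy_convergent_iff convergent_def)
  \<comment> \<open>The squared distance is continuous, so it moves to the right-hand side and lower
    semicontinuity is applied to \<open>h\<close> alone.\<close>
  have "(\<lambda>n. m + 1 / Suc n - (norm (z n - y))\<^sup>2 / (2 * \<alpha>)) \<longlonglongrightarrow> m + 0 - (norm (p - y))\<^sup>2 / (2 * \<alpha>)"
    using \<alpha> LIMSEQ_Suc[OF lim_1_over_n] by (intro tendsto_intros p) auto
  moreover have "h (z n) \<le> ereal (m + 1 / Suc n - (norm (z n - y))\<^sup>2 / (2 * \<alpha>))" for n
    using proper_fun_finite[OF h(1) z(1)[of n]] z(2)[of n] unfolding \<phi>_def r_def
    by (metis (no_types, lifting) add_less_imp_less_right diff_add_cancel ereal_less_eq(3) less_imp_le)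
  ultimately have hp: "h p \<le> ereal (m + 0 - (norm (p - y))\<^sup>2 / (2 * \<alpha>))"
    by (intro lsc_fun_le_limit[OF h(2) p]) auto
  then have pD: "p \<in> edom h" by (rule edomI)
  have "\<phi> p \<le> m"
    using hp proper_fun_finite[OF h(1) pD] unfolding \<phi>_def r_def
    by (metis add.right_neutral ereal_less_eq(3) le_diff_eq)
  then have min: "\<phi> p \<le> \<phi> u" if "u \<in> edom h" for u
    using m_le[OF that] by linarith
  have "(1 / \<alpha>) *\<^sub>R (y - p) \<in> subdifferential h p"
  proof (rule subdifferentialI[OF h(1) pD])
    fix u assume u: "u \<in> edom h"
    define A where "A = (p - y) \<bullet> (u - p)"
    define B where "B = (norm (u - p))\<^sup>2"
    \<comment> \<open>First-order optimality: minimality of \<open>p\<close> is tested along the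
      segment towards \<open>u\<close> and divided by t. As t tends to 0, the term with
      \<open>B\<close> vanishes and the subgradient inequality remains.\<close>
    have "r p \<le> r u + A / \<alpha> + t * (B / (2 * \<alpha>))" if t: "0 < t" "t < 1" for t
    proof -
      let ?w = "(1 - t) *\<^sub>R p + t *\<^sub>R u"
      have w: "?w - y = (p - y) + t *\<^sub>R (u - p)" by (simp add: algebra_simps)
      have nw: "(norm (?w - y))\<^sup>2 = (norm (p - y))\<^sup>2 + 2 * t * A + t\<^sup>2 * B"
        unfolding w power2_norm_eq_inner A_def B_def
        by (simp add: inner_add_left inner_add_right inner_commute power2_eq_square algebra_simps)
      have "\<phi> p \<le> \<phi> ?w" by (rule min) (rule convex_fun_edom(1)[OF h(1,3) pD u t])
      also have "\<phi> ?w \<le> (1 - t) * r p + t * r u + ((norm (p - y))\<^sup>2 + 2 * t * A + t\<^sup>2 * B) / (2 * \<alpha>)"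
        using convex_fun_edom(2)[OF h(1,3) pD u t] unfolding \<phi>_def nw r_def by simp
      finally have "t * r p \<le> t * r u + (2 * t * A + t\<^sup>2 * B) / (2 * \<alpha>)"
        unfolding \<phi>_def by (simp add: algebra_simps add_divide_distrib)
      also have "\<dots> = t * (r u + A / \<alpha> + t * (B / (2 * \<alpha>)))"
        using \<alpha> by (simp add: field_simps power2_eq_square)
      finally show ?thesis using t by simp
    qed
    then have "\<forall>\<^sub>F t in at_right 0. r p \<le> r u + A / \<alpha> + t * (B / (2 * \<alpha>))"
      by (intro eventually_at_rightI[of 0 1]) auto
    moreover have "((\<lambda>t. r u + A / \<alpha> + t * (B / (2 * \<alpha>))) \<longlongrightarrow> r u + A / \<alpha> + 0 * (B / (2 * \<alpha>))) (at_right 0)"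
      by (intro tendsto_intros)
    ultimately have "r p \<le> r u + A / \<alpha> + 0 * (B / (2 * \<alpha>))"
      by (intro tendsto_lowerbound) auto
    moreover have "((1 / \<alpha>) *\<^sub>R (y - p)) \<bullet> (u - p) = - (A / \<alpha>)"
      unfolding A_def by (simp add: inner_diff_left diff_divide_distrib)
    ultimately show "real_of_ereal (h p) + ((1 / \<alpha>) *\<^sub>R (y - p)) \<bullet> (u - p) \<le> real_of_ereal (h u)"
      by (simp add: r_def)
  qed
  moreover have "y = p + \<alpha> *\<^sub>R ((1 / \<alpha>) *\<^sub>R (y - p))" using \<alpha> by simp
  ultimately show ?thesis by blast
qed

lemma subdifferential_monotone:
  assumes "proper_fun h" "v \<in> subdifferential h p" "w \<in> subdifferential h q"
  shows "(v - w) \<bullet> (p - q) \<ge> 0"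
proof -
  have "real_of_ereal (h p) + v \<bullet> (q - p) \<le> real_of_ereal (h q)"
    "real_of_ereal (h q) + w \<bullet> (p - q) \<le> real_of_ereal (h p)"
    using subdifferentialD[OF assms(1)] assms(2,3) by blast+
  then show ?thesis by (simp add: inner_diff_left inner_diff_right)
qed

text \<open>Monotonicity makes the inner product of v - w and p - q nonnegative, while p - q =
  -\<alpha> (v - w) makes it nonpositive; hence v = w.\<close>

lemma prox_point_unique:
  fixes h :: "'a::real_inner \<Rightarrow> ereal"
  assumes "proper_fun h" "\<alpha> > 0"
    and "v \<in> subdifferential h p" "y = p + \<alpha> *\<^sub>R v"
    and "w \<in> subdifferential h q" "y = q + \<alpha> *\<^sub>R w"
  shows "p = q"
proof -
  have "p - q = - (\<alpha> *\<^sub>R (v - w))"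
    using assms(4,6) by (simp add: algebra_simps)
  then have "(v - w) \<bullet> (p - q) = - (\<alpha> * ((v - w) \<bullet> (v - w)))"
    by simp
  then have "(v - w) \<bullet> (v - w) \<le> 0"
    using subdifferential_monotone[OF assms(1,3,5)] assms(2)
    by (simp add: mult_le_0_iff)
  then have "v = w" by (metis inner_gt_zero_iff linorder_not_le right_minus_eq)
  then show ?thesis using assms(4,6) by simp
qed

text \<open>Existence and uniqueness justify the description operator in \<open>prox\<close>. Later
  arguments reach the operator only through this inclusion and \<open>prox_eqI\<close>.\<close>

lemma prox_subgradient:
  fixes h :: "'a::{real_inner, complete_space} \<Rightarrow> ereal"
  assumes h: "proper_fun h" "lsc_fun h" "convex_fun h" and \<alpha>: "\<alpha> > 0"
  shows "(1 / \<alpha>) *\<^sub>R (y - prox \<alpha> h y) \<in> subdifferential h (prox \<alpha> h y)"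
proof -
  have "\<exists>!p. \<exists>v\<in>subdifferential h p. y = p + \<alpha> *\<^sub>R v"
    using prox_point_exists[OF h \<alpha>] prox_point_unique[OF h(1) \<alpha>] by blast
  from theI'[OF this] obtain v where
    v: "v \<in> subdifferential h (prox \<alpha> h y)" "y = prox \<alpha> h y + \<alpha> *\<^sub>R v"
    unfolding prox_def by blast
  have "y - prox \<alpha> h y = \<alpha> *\<^sub>R v"
    using v(2) by (metis add_diff_cancel_left')
  then have "(1 / \<alpha>) *\<^sub>R (y - prox \<alpha> h y) = v"
    using \<alpha> by simp
  then show ?thesis using v(1) by simp
qed

lemma prox_eqI:
  fixes h :: "'a::{real_inner, complete_space} \<Rightarrow> ereal"
  assumes h: "proper_fun h" "\<alpha> > 0" and v: "v \<in> subdifferential h p"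
  shows "prox \<alpha> h (p + \<alpha> *\<^sub>R v) = p"
  unfolding prox_def
  using v prox_point_unique[OF h v refl] by (intro the_equality) blast+

text \<open>The proximal point of a bounded linear functional at the origin yields its representer.\<close>

lemma riesz_representation:
  fixes l :: "'a::{real_inner, complete_space} \<Rightarrow> real"
  assumes "bounded_linear l"
  shows "\<exists>d. \<forall>z. l z = z \<bullet> d"
proof -
  interpret bounded_linear l by fact
  let ?h = "\<lambda>z. ereal (l z)"
  have dom: "edom ?h = UNIV" by (auto simp: edom_def)
  have "proper_fun ?h" by (auto simp: proper_fun_def dom)
  moreover have "convex_fun ?h" by (auto simp: convex_fun_def add scaleR)
  moreover have "lsc_fun ?h"
    unfolding lsc_fun_def
  proof
    fix z
    have "isCont l z" by (rule isCont) auto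
    then have "(?h \<longlongrightarrow> ?h z) (at z)" by (simp add: isCont_def)
    \<comment> \<open>In the zero space the filter \<open>at z\<close> is trivial and its Liminf is
      the top element.\<close>
    then show "?h z \<le> Liminf (at z) ?h"
      by (cases "at z = bot") (auto dest: lim_imp_Liminf)
  qed
  ultimately obtain p d where pd: "d \<in> subdifferential ?h p"
    using prox_point_exists[of ?h 1 0] by auto
  have le: "d \<bullet> u \<le> l u" for u
  proof -
    have "?h p + ereal (d \<bullet> (p + u - p)) \<le> ?h (p + u)"
      using pd unfolding subdifferential_def by blast
    then show ?thesis by (simp add: add)
  qed
  \<comment> \<open>By linearity, the inequality for u and for -u together give equality.\<close>
  have "l u = u \<bullet> d" for u
    using le[of u] le[of "- u"] scaleR[of "-1" u] by (simp add: inner_commute)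
  then show ?thesis by blast
qed

section \<open>A single forward-backward step\<close>

locale forward_backward =
  fixes f g :: "'a::{real_inner, complete_space} \<Rightarrow> ereal"
  assumes A1: "assumption_A1 f g" and A2: "assumption_A2 f g"
begin

abbreviation fr :: "'a \<Rightarrow> real" where "fr z \<equiv> real_of_ereal (f z)"
abbreviation gr :: "'a \<Rightarrow> real" where "gr z \<equiv> real_of_ereal (g z)"
abbreviation obj :: "'a \<Rightarrow> real" where "obj z \<equiv> fr z + gr z"

lemma
  shows f: "proper_fun f" "lsc_fun f" "convex_fun f"
    and g: "proper_fun g" "lsc_fun g" "convex_fun g"
    and dom_fg: "z \<in> edom g \<Longrightarrow> z \<in> edom f"
  using A1 by (auto simp: assumption_A1_def)

text \<open>The Riesz representer of the derivative is a gradient, and uniqueness of derivatives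
  makes it the value of the description in \<open>grad\<close>.\<close>

lemma grad_has_derivative:
  assumes "z \<in> edom g"
  shows "(fr has_derivative (\<lambda>h. h \<bullet> grad f z)) (at z)"
proof -
  have "fr differentiable (at z)"
    using A2 assms by (auto simp: assumption_A2_def frechet_differentiable_at_def)
  then obtain l where l: "(fr has_derivative l) (at z)"
    by (auto simp: differentiable_def)
  obtain d where "l = (\<lambda>h. h \<bullet> d)"
    using riesz_representation[OF has_derivative_bounded_linear[OF l]] by blast
  then have d: "GDERIV fr z :> d"
    using l by (simp add: gderiv_def)
  have "e = d" if "GDERIV fr z :> e" for e
  proof -
    have "(\<lambda>h. h \<bullet> e) = (\<lambda>h. h \<bullet> d)"
      using that d unfolding gderiv_def by (rule has_derivative_unique)
    then show ?thesis by (metis inner_commute vector_eq_rdot)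
  qed
  with d have "GDERIV fr z :> grad f z"
    unfolding grad_def by (rule theI)
  then show ?thesis by (simp add: gderiv_def)
qed

text \<open>By convexity the difference quotients of f along the segment from z to u are at most
  \<open>fr u - fr z\<close>; as t decreases to 0 they tend to the directional derivative.\<close>

lemma grad_inequality:
  assumes z: "z \<in> edom g" and u: "u \<in> edom g"
  shows "fr z + grad f z \<bullet> (u - z) \<le> fr u"
proof -
  let ?p = "\<lambda>t. z + t *\<^sub>R (u - z)"
  have "(?p has_derivative (\<lambda>t. t *\<^sub>R (u - z))) (at 0)"
    by (auto intro!: derivative_eq_intros)
  moreover have "(fr has_derivative (\<lambda>h. h \<bullet> grad f z)) (at (?p 0))"
    using grad_has_derivative[OF z] by simp
  ultimately have "((\<lambda>t. fr (?p t)) has_derivative (\<lambda>t. t *\<^sub>R (u - z) \<bullet> grad f z)) (at 0)"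
    by (rule has_derivative_compose)
  then have "((\<lambda>t. fr (?p t)) has_field_derivative (grad f z \<bullet> (u - z))) (at 0)"
    by (simp add: has_field_derivative_def mult.commute[of _ "grad f z \<bullet> (u - z)"] inner_commute)
  then have "((\<lambda>t. (fr (?p t) - fr z) / t) \<longlongrightarrow> grad f z \<bullet> (u - z)) (at 0)"
    by (simp add: has_field_derivative_iff)
  then have lim: "((\<lambda>t. (fr (?p t) - fr z) / t) \<longlongrightarrow> grad f z \<bullet> (u - z)) (at_right 0)"
    by (rule filterlim_mono) (auto simp: at_le)
  have "(fr (?p t) - fr z) / t \<le> fr u - fr z" if t: "0 < t" "t < 1" for t
  proof -
    have "?p t = (1 - t) *\<^sub>R z + t *\<^sub>R u" by (simp add: algebra_simps)
    then have "fr (?p t) \<le> (1 - t) * fr z + t * fr u"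
      using convex_fun_edom(2)[OF f(1,3) dom_fg[OF z] dom_fg[OF u] t] by simp
    then show ?thesis using t by (simp add: field_simps)
  qed
  then have "\<forall>\<^sub>F t in at_right 0. (fr (?p t) - fr z) / t \<le> fr u - fr z"
    by (intro eventually_at_rightI[of 0 1]) auto
  then have "grad f z \<bullet> (u - z) \<le> fr u - fr z"
    by (intro tendsto_upperbound[OF lim]) auto
  then show ?thesis by simp
qed

text \<open>Sequential form of the uniform continuity in (A2). Neither sequence has to converge,
  which suits iterates and trial points in infinite dimension.\<close>

lemma grad_tendsto:
  assumes "bounded B" "B \<subseteq> edom g" "\<And>n. u n \<in> B" "\<And>n. v n \<in> B" "(\<lambda>n. u n - v n) \<longlonglongrightarrow> 0"
  shows "(\<lambda>n. grad f (u n) - grad f (v n)) \<longlonglongrightarrow> 0"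
proof -
  have "uniformly_continuous_on B (grad f)"
    using A2 assms(1,2) by (auto simp: assumption_A2_def)
  moreover have "(\<lambda>n. dist (u n) (v n)) \<longlonglongrightarrow> 0"
    using assms(5) by (simp add: dist_norm tendsto_norm_zero)
  ultimately have "(\<lambda>n. dist (grad f (u n)) (grad f (v n))) \<longlonglongrightarrow> 0"
    using assms(3,4) unfolding uniformly_continuous_on_sequentially by blast
  then show ?thesis by (simp add: dist_norm tendsto_norm_zero_iff)
qed

lemma fb_step_subgradient:
  assumes "\<alpha> > 0"
  shows "(1 / \<alpha>) *\<^sub>R (z - fb_step f g z \<alpha>) - grad f z \<in> subdifferential g (fb_step f g z \<alpha>)"
proof -
  let ?p = "fb_step f g z \<alpha>"
  have "(1 / \<alpha>) *\<^sub>R (z - \<alpha> *\<^sub>R grad f z - ?p) = (1 / \<alpha>) *\<^sub>R (z - ?p) - grad f z"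
    using assms by (simp add: algebra_simps)
  then show ?thesis
    using prox_subgradient[OF g assms, of "z - \<alpha> *\<^sub>R grad f z"] by (simp add: fb_step_def)
qed

lemma fb_step_in_dom: "\<alpha> > 0 \<Longrightarrow> fb_step f g z \<alpha> \<in> edom g"
  using fb_step_subgradient subdifferentialD(1)[OF g(1)] by blast

lemma fb_step_g_le:
  assumes "\<alpha> > 0" "u \<in> edom g"
  shows "gr (fb_step f g z \<alpha>)
    \<le> gr u - ((1 / \<alpha>) *\<^sub>R (z - fb_step f g z \<alpha>) - grad f z) \<bullet> (u - fb_step f g z \<alpha>)"
  using subdifferentialD(2)[OF g(1) fb_step_subgradient[OF assms(1)] assms(2), of z] by linarith

lemma fb_step_fixed:
  assumes "\<alpha> > 0" "- grad f z \<in> subdifferential g z"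
  shows "fb_step f g z \<alpha> = z"
  using prox_eqI[OF g(1) assms] by (simp add: fb_step_def)

text \<open>Let A and B be the displacements for \<alpha> and \<beta>. Monotonicity of the
  subdifferential, where \<open>grad f z\<close> cancels, and Cauchy-Schwarz give 0 \<le> (B - A)
  (\<beta> A - \<alpha> B). If A > B, the factors have opposite signs, so A \<le> B; the second
  factor is then nonnegative too, where A = B is settled by \<alpha> \<le> \<beta>.\<close>

lemma fb_step_scaling:
  assumes \<alpha>\<beta>: "0 < \<alpha>" "\<alpha> \<le> \<beta>"
  shows "norm (z - fb_step f g z \<alpha>) \<le> norm (z - fb_step f g z \<beta>)"
    and "\<alpha> * norm (z - fb_step f g z \<beta>) \<le> \<beta> * norm (z - fb_step f g z \<alpha>)"
proof -
  have \<beta>: "\<beta> > 0" using \<alpha>\<beta> by simp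
  define a where "a = z - fb_step f g z \<alpha>"
  define b where "b = z - fb_step f g z \<beta>"
  define A where "A = norm a"
  define B where "B = norm b"
  have "((1 / \<alpha>) *\<^sub>R a - (1 / \<beta>) *\<^sub>R b) \<bullet> (b - a) \<ge> 0"
    using subdifferential_monotone[OF g(1) fb_step_subgradient[OF \<alpha>\<beta>(1)] fb_step_subgradient[OF \<beta>], of z z]
    by (simp add: a_def b_def)
  then have "0 \<le> (\<alpha> * \<beta>) * (((1 / \<alpha>) *\<^sub>R a - (1 / \<beta>) *\<^sub>R b) \<bullet> (b - a))"
    using \<alpha>\<beta>(1) \<beta> by simp
  also have "\<dots> = (\<alpha> + \<beta>) * (a \<bullet> b) - \<beta> * A\<^sup>2 - \<alpha> * B\<^sup>2"
    using \<alpha>\<beta>(1) \<beta> unfolding A_def B_def power2_norm_eq_inner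
    by (simp add: inner_diff_left inner_diff_right inner_commute field_simps)
  also have "\<dots> \<le> (\<alpha> + \<beta>) * (A * B) - \<beta> * A\<^sup>2 - \<alpha> * B\<^sup>2"
    using norm_cauchy_schwarz[of a b] \<alpha>\<beta>(1) \<beta> by (simp add: A_def B_def)
  also have "\<dots> = (B - A) * (\<beta> * A - \<alpha> * B)"
    by (simp add: algebra_simps power2_eq_square)
  finally have prod: "0 \<le> (B - A) * (\<beta> * A - \<alpha> * B)" .
  have nn: "A \<ge> 0" "B \<ge> 0" by (auto simp: A_def B_def)
  have AB: "A \<le> B"
  proof (rule ccontr)
    assume "\<not> A \<le> B"
    moreover from this have "\<beta> * A > \<alpha> * B"
      using \<alpha>\<beta> nn by (meson linorder_not_le mult_le_less_imp_less)
    ultimately show False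
      using prod by (smt (verit) mult_neg_pos)
  qed
  have "\<alpha> * B \<le> \<beta> * A"
  proof (cases "A = B")
    case True
    then show ?thesis using \<alpha>\<beta> nn by (simp add: mult_right_mono)
  next
    case False
    then show ?thesis using AB prod by (simp add: zero_le_mult_iff)
  qed
  with AB show "norm (z - fb_step f g z \<alpha>) \<le> norm (z - fb_step f g z \<beta>)"
    "\<alpha> * norm (z - fb_step f g z \<beta>) \<le> \<beta> * norm (z - fb_step f g z \<alpha>)"
    by (auto simp: A_def B_def a_def b_def)
qed

text \<open>The vector \<open>?v\<close> acts as a subgradient of f + g at the new point, so a small
  \<open>?v\<close> means near optimality. The line search test is not assumed, so this applies to
  rejected trial points.\<close>

lemma fb_step_obj_le:
  assumes \<alpha>: "\<alpha> > 0" and u: "u \<in> edom g"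
  shows "obj (fb_step f g z \<alpha>) \<le> obj u
    + (norm (z - fb_step f g z \<alpha>) / \<alpha> + norm (grad f (fb_step f g z \<alpha>) - grad f z))
      * norm (u - fb_step f g z \<alpha>)"
proof -
  let ?p = "fb_step f g z \<alpha>"
  let ?v = "(1 / \<alpha>) *\<^sub>R (z - ?p) + (grad f ?p - grad f z)"
  have "- (?v \<bullet> (u - ?p)) \<le> norm ?v * norm (u - ?p)"
    using Cauchy_Schwarz_ineq2[of ?v "u - ?p"] by linarith
  also have "norm ?v \<le> norm (z - ?p) / \<alpha> + norm (grad f ?p - grad f z)"
    using \<alpha> by (intro norm_triangle_le) simp
  finally have "- (?v \<bullet> (u - ?p))
      \<le> (norm (z - ?p) / \<alpha> + norm (grad f ?p - grad f z)) * norm (u - ?p)"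
    by (simp add: mult_right_mono)
  moreover have "obj ?p \<le> obj u - ?v \<bullet> (u - ?p)"
    using fb_step_g_le[OF \<alpha> u, of z] grad_inequality[OF fb_step_in_dom[OF \<alpha>] u, of z]
    by (simp add: inner_diff_left inner_add_left)
  ultimately show ?thesis by linarith
qed

text \<open>f is linearized at z against u and at the new point against z, so that the error is the
  product of the gradient difference with the displacement, which the acceptance test
  controls.\<close>

lemma fb_step_fejer:
  assumes z: "z \<in> edom g" and u: "u \<in> edom g" and \<alpha>: "\<alpha> > 0"
    and ls: "\<alpha> * norm (grad f (fb_step f g z \<alpha>) - grad f z) \<le> \<delta> * norm (fb_step f g z \<alpha> - z)"
  shows "2 * \<alpha> * (obj (fb_step f g z \<alpha>) - obj u) + (1 - 2 * \<delta>) * (norm (z - fb_step f g z \<alpha>))\<^sup>2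
    \<le> (norm (z - u))\<^sup>2 - (norm (fb_step f g z \<alpha> - u))\<^sup>2"
proof -
  define p where "p = fb_step f g z \<alpha>"
  have pD: "p \<in> edom g" unfolding p_def by (rule fb_step_in_dom[OF \<alpha>])
  have "obj p - obj u \<le> - (((1 / \<alpha>) *\<^sub>R (z - p) - grad f z) \<bullet> (u - p))
      - grad f z \<bullet> (u - z) - grad f p \<bullet> (z - p)"
    using fb_step_g_le[OF \<alpha> u, of z] grad_inequality[OF z u] grad_inequality[OF pD z]
    unfolding p_def by linarith
  also have "\<dots> = - ((z - p) \<bullet> (u - p)) / \<alpha> + (grad f p - grad f z) \<bullet> (p - z)"
    by (simp add: inner_diff_left inner_diff_right diff_divide_distrib)
  finally have "2 * \<alpha> * (obj p - obj u)
      \<le> 2 * \<alpha> * (- ((z - p) \<bullet> (u - p)) / \<alpha> + (grad f p - grad f z) \<bullet> (p - z))"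
    using \<alpha> by (intro mult_left_mono) auto
  also have "\<dots> = - 2 * ((z - p) \<bullet> (u - p)) + 2 * (\<alpha> * ((grad f p - grad f z) \<bullet> (p - z)))"
    using \<alpha> by (simp add: field_simps)
  finally have *: "2 * \<alpha> * (obj p - obj u)
      \<le> - 2 * ((z - p) \<bullet> (u - p)) + 2 * (\<alpha> * ((grad f p - grad f z) \<bullet> (p - z)))" .
  have "\<alpha> * ((grad f p - grad f z) \<bullet> (p - z)) \<le> \<alpha> * (norm (grad f p - grad f z) * norm (p - z))"
    using \<alpha> by (intro mult_left_mono norm_cauchy_schwarz) auto
  also have "\<dots> = (\<alpha> * norm (grad f p - grad f z)) * norm (p - z)" by simp
  also have "\<dots> \<le> (\<delta> * norm (p - z)) * norm (p - z)"
    using ls unfolding p_def by (rule mult_right_mono) auto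
  also have "\<dots> = \<delta> * (norm (z - p))\<^sup>2"
    by (simp add: power2_eq_square norm_minus_commute)
  finally have **: "\<alpha> * ((grad f p - grad f z) \<bullet> (p - z)) \<le> \<delta> * (norm (z - p))\<^sup>2" .
  \<comment> \<open>The three-point identity turns the inner product into a difference of squared
    distances to u.\<close>
  have "- 2 * ((z - p) \<bullet> (u - p)) = (norm (z - u))\<^sup>2 - (norm (p - u))\<^sup>2 - (norm (z - p))\<^sup>2"
    unfolding power2_norm_eq_inner
    by (simp add: inner_diff_left inner_diff_right inner_commute)
  with * ** show ?thesis unfolding p_def[symmetric]
    by (simp add: algebra_simps)
qed

text \<open>If all trials failed, the points \<open>p n\<close> would tend to z. The failed tests
  and continuity of the gradient would make the displacements vanish even after division by
  \<open>\<alpha> n\<close>, so the subgradient inequality in the limit would make z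
  stationary.\<close>

lemma linesearch_condition_satisfiable:
  assumes z: "z \<in> edom g" and pars: "\<sigma> > 0" "0 < \<theta>" "\<theta> < 1" "\<delta> > 0"
  shows "\<exists>n. (\<theta> ^ n * \<sigma>) * norm (grad f (fb_step f g z (\<theta> ^ n * \<sigma>)) - grad f z)
    \<le> \<delta> * norm (fb_step f g z (\<theta> ^ n * \<sigma>) - z)"
proof (rule ccontr)
  define \<alpha> where "\<alpha> n = \<theta> ^ n * \<sigma>" for n
  define p where "p n = fb_step f g z (\<alpha> n)" for n
  assume "\<not> ?thesis"
  then have fail: "\<alpha> n * norm (grad f (p n) - grad f z) > \<delta> * norm (p n - z)" for n
    by (auto simp: \<alpha>_def p_def not_le)
  have \<alpha>: "\<alpha> n > 0" "\<alpha> n \<le> \<sigma>" for n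
    using pars by (auto simp: \<alpha>_def mult_le_cancel_right1 power_le_one)
  have pD: "p n \<in> edom g" for n
    unfolding p_def by (rule fb_step_in_dom[OF \<alpha>(1)])
  \<comment> \<open>By \<open>fb_step_scaling\<close> the first trial has the largest
    displacement.\<close>
  define M where "M = norm (z - fb_step f g z \<sigma>)"
  have M: "norm (z - p n) \<le> M" for n
    unfolding M_def p_def by (rule fb_step_scaling(1)[OF \<alpha>])
  obtain a b where ab: "\<And>u. u \<in> edom g \<Longrightarrow> a - b * norm (u - z) \<le> gr u"
    using proper_lsc_convex_minorant[OF g, of z] by blast
  \<comment> \<open>Collects the bounds for the right-hand side of the subgradient inequality tested
    at z; \<open>a\<close> and \<open>b\<close> bound g from below near z.\<close>
  define C where "C = gr z - a + \<bar>b\<bar> * M + norm (grad f z) * M"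
  have sq_bound: "(norm (z - p n))\<^sup>2 \<le> \<alpha> n * C" for n
  proof -
    have "gr (p n) \<le> gr z - ((1 / \<alpha> n) *\<^sub>R (z - p n) - grad f z) \<bullet> (z - p n)"
      unfolding p_def by (rule fb_step_g_le[OF \<alpha>(1) z])
    then have "(norm (z - p n))\<^sup>2 / \<alpha> n \<le> gr z - gr (p n) + grad f z \<bullet> (z - p n)"
      by (simp add: inner_diff_left power2_norm_eq_inner)
    moreover have "a - \<bar>b\<bar> * M \<le> gr (p n)"
    proof -
      have "b * norm (p n - z) \<le> \<bar>b\<bar> * M"
        using M[of n] by (intro mult_mono) (auto simp: norm_minus_commute)
      then show ?thesis using ab[OF pD, of n] by linarith
    qed
    moreover have "grad f z \<bullet> (z - p n) \<le> norm (grad f z) * M"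
      using norm_cauchy_schwarz M[of n] by (meson mult_left_mono norm_ge_zero order_trans)
    ultimately have "(norm (z - p n))\<^sup>2 / \<alpha> n \<le> C"
      unfolding C_def by linarith
    then show ?thesis using \<alpha>(1)[of n] by (simp add: field_simps)
  qed
  have "(\<lambda>n. \<theta> ^ n) \<longlonglongrightarrow> 0"
    using pars by (intro LIMSEQ_realpow_zero) auto
  then have "(\<lambda>n. \<alpha> n * C) \<longlonglongrightarrow> 0"
    unfolding \<alpha>_def by (intro tendsto_mult_left_zero)
  then have "(\<lambda>n. (norm (z - p n))\<^sup>2) \<longlonglongrightarrow> 0"
    by (rule tendsto_sandwich[OF _ _ tendsto_const, rotated 2]) (auto simp: sq_bound)
  then have "(\<lambda>n. norm (z - p n)) \<longlonglongrightarrow> 0"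
    using tendsto_real_sqrt[of "\<lambda>n. (norm (z - p n))\<^sup>2" 0] by simp
  then have zp: "(\<lambda>n. z - p n) \<longlonglongrightarrow> 0"
    by (rule tendsto_norm_zero_cancel)
  then have p: "p \<longlonglongrightarrow> z"
    using tendsto_diff[OF tendsto_const[of z] zp] by simp
  have "bounded (insert z (range p))"
    using convergent_imp_bounded[OF p] by simp
  then have grad_lim: "(\<lambda>n. grad f (p n) - grad f z) \<longlonglongrightarrow> 0"
    using z pD p by (intro grad_tendsto[where B = "insert z (range p)"]) (auto simp: LIM_zero)
  have "(\<lambda>n. (1 / \<alpha> n) *\<^sub>R (z - p n)) \<longlonglongrightarrow> 0"
  proof (rule tendsto_norm_zero_cancel, rule tendsto_sandwich[OF _ _ tendsto_const])
    show "(\<lambda>n. norm (grad f (p n) - grad f z) / \<delta>) \<longlonglongrightarrow> 0"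
      by (intro tendsto_divide_zero tendsto_norm_zero grad_lim)
    show "\<forall>\<^sub>F n in sequentially. norm ((1 / \<alpha> n) *\<^sub>R (z - p n)) \<le> norm (grad f (p n) - grad f z) / \<delta>"
    proof (intro always_eventually allI)
      fix n
      have "norm ((1 / \<alpha> n) *\<^sub>R (z - p n)) = norm (p n - z) / \<alpha> n"
        using \<alpha>(1)[of n] by (simp add: norm_minus_commute)
      also have "\<dots> \<le> norm (grad f (p n) - grad f z) / \<delta>"
        using fail[of n] \<alpha>(1)[of n] pars(4) by (simp add: field_simps)
      finally show "norm ((1 / \<alpha> n) *\<^sub>R (z - p n)) \<le> norm (grad f (p n) - grad f z) / \<delta>" .
    qed
  qed auto
  note lim = this
  have "- grad f z \<in> subdifferential g z"
  proof (rule subdifferentialI[OF g(1) z])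
    fix u assume u: "u \<in> edom g"
    have "(\<lambda>n. gr u - ((1 / \<alpha> n) *\<^sub>R (z - p n) - grad f z) \<bullet> (u - p n))
        \<longlonglongrightarrow> gr u - (0 - grad f z) \<bullet> (u - z)"
      by (intro tendsto_intros lim p)
    moreover have "g (p n) \<le> ereal (gr u - ((1 / \<alpha> n) *\<^sub>R (z - p n) - grad f z) \<bullet> (u - p n))" for n
      using fb_step_g_le[OF \<alpha>(1) u, of z n] proper_fun_finite[OF g(1) pD[of n]]
      unfolding p_def by (metis ereal_less_eq(3))
    ultimately have "g z \<le> ereal (gr u - (0 - grad f z) \<bullet> (u - z))"
      by (intro lsc_fun_le_limit[OF g(2) p]) auto
    then have "gr z \<le> gr u - (0 - grad f z) \<bullet> (u - z)"
      using proper_fun_finite[OF g(1) z] by (metis ereal_less_eq(3))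
    then show "gr z + - grad f z \<bullet> (u - z) \<le> gr u" by simp
  qed
  \<comment> \<open>From a stationary point the step stays put, and the test holds with both sides
    0.\<close>
  then have "p 0 = z"
    unfolding p_def by (rule fb_step_fixed[OF \<alpha>(1)])
  then show False using fail[of 0] by simp
qed

text \<open>\<open>while\<close> unfolds to a least exponent. If it is positive, its predecessor
  failed the test; this failure is the source of the lower bounds on the step sizes.\<close>

lemma linesearch1_spec:
  fixes \<sigma> \<theta> \<delta> :: real
  assumes z: "z \<in> edom g" and pars: "\<sigma> > 0" "0 < \<theta>" "\<theta> < 1" "\<delta> > 0"
  defines "\<alpha> \<equiv> linesearch1 f g z \<sigma> \<theta> \<delta>"
  shows "\<alpha> > 0"
    and "\<alpha> * norm (grad f (fb_step f g z \<alpha>) - grad f z) \<le> \<delta> * norm (fb_step f g z \<alpha> - z)"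
    and "\<alpha> = \<sigma> \<or> \<delta> * norm (fb_step f g z (\<alpha> / \<theta>) - z)
      < \<alpha> / \<theta> * norm (grad f (fb_step f g z (\<alpha> / \<theta>)) - grad f z)"
proof -
  define b where "b = (\<lambda>\<alpha>. \<alpha> * norm (grad f (fb_step f g z \<alpha>) - grad f z) > \<delta> * norm (fb_step f g z \<alpha> - z))"
  have pow: "((\<lambda>\<alpha>. \<theta> * \<alpha>) ^^ n) \<sigma> = \<theta> ^ n * \<sigma>" for n
    by (induction n) auto
  have ex: "\<exists>n. \<not> b (\<theta> ^ n * \<sigma>)"
    using linesearch_condition_satisfiable[OF z pars] by (simp add: b_def not_less)
  define n where "n = (LEAST n. \<not> b (\<theta> ^ n * \<sigma>))"
  have \<alpha>: "\<alpha> = \<theta> ^ n * \<sigma>"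
    using ex by (simp add: \<alpha>_def linesearch1_def while_def while_option_def pow n_def b_def)
  show "\<alpha> > 0" using pars by (simp add: \<alpha>)
  have "\<not> b \<alpha>"
    unfolding \<alpha> n_def using ex by (rule LeastI_ex)
  then show "\<alpha> * norm (grad f (fb_step f g z \<alpha>) - grad f z) \<le> \<delta> * norm (fb_step f g z \<alpha> - z)"
    by (simp add: b_def not_less)
  have "\<alpha> = \<sigma> \<or> b (\<alpha> / \<theta>)"
  proof (cases n)
    case 0
    then show ?thesis by (simp add: \<alpha>)
  next
    case (Suc m)
    then have "b (\<theta> ^ m * \<sigma>)"
      using not_less_Least[of m "\<lambda>n. \<not> b (\<theta> ^ n * \<sigma>)"] by (simp add: n_def)
    moreover have "\<alpha> / \<theta> = \<theta> ^ m * \<sigma>"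
      using pars Suc by (simp add: \<alpha>)
    ultimately show ?thesis by simp
  qed
  then show "\<alpha> = \<sigma> \<or> \<delta> * norm (fb_step f g z (\<alpha> / \<theta>) - z)
      < \<alpha> / \<theta> * norm (grad f (fb_step f g z (\<alpha> / \<theta>)) - grad f z)"
    by (simp add: b_def)
qed

end

section \<open>Compactness and decreasing summable sequences\<close>

text \<open>By induction, each new vector contributes the sum with a compact segment.\<close>

lemma compact_linear_combinations:
  fixes C :: "'a::real_normed_vector set" and M :: "'a \<Rightarrow> real"
  assumes "finite C"
  shows "compact {\<Sum>c\<in>C. t c *\<^sub>R c | t. \<forall>c\<in>C. \<bar>t c\<bar> \<le> M c}"
  using assms
proof (induction C rule: finite_induct)
  case empty
  then show ?case by simp
next
  case (insert b C)
  let ?K = "\<lambda>C. {\<Sum>c\<in>C. t c *\<^sub>R c | t. \<forall>c\<in>C. \<bar>t c\<bar> \<le> M c}"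
  have "?K (insert b C) = {u + v | u v. u \<in> (\<lambda>t. t *\<^sub>R b) ` {- M b..M b} \<and> v \<in> ?K C}" (is "_ = ?R")
  proof
    show "?K (insert b C) \<subseteq> ?R"
    proof
      fix y assume "y \<in> ?K (insert b C)"
      then obtain t where t: "y = (\<Sum>c\<in>insert b C. t c *\<^sub>R c)" "\<forall>c\<in>insert b C. \<bar>t c\<bar> \<le> M c"
        by blast
      have "y = t b *\<^sub>R b + (\<Sum>c\<in>C. t c *\<^sub>R c)"
        using insert.hyps t(1) by simp
      moreover have "t b *\<^sub>R b \<in> (\<lambda>t. t *\<^sub>R b) ` {- M b..M b}"
        using t(2) by (intro imageI) (auto simp: abs_le_iff)
      ultimately show "y \<in> ?R" using t(2) by blast
    qed
    show "?R \<subseteq> ?K (insert b C)"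
    proof
      fix y assume "y \<in> ?R"
      then obtain s t where st: "y = s *\<^sub>R b + (\<Sum>c\<in>C. t c *\<^sub>R c)" "\<bar>s\<bar> \<le> M b" "\<forall>c\<in>C. \<bar>t c\<bar> \<le> M c"
        by (force simp: abs_le_iff)
      \<comment> \<open>Overwriting the coefficient of \<open>b\<close> does not affect the sum over
        \<open>C\<close>, as \<open>b\<close> lies outside \<open>C\<close>.\<close>
      have "(\<Sum>c\<in>C. (t(b := s)) c *\<^sub>R c) = (\<Sum>c\<in>C. t c *\<^sub>R c)"
        using insert.hyps by (intro sum.cong) auto
      then have "y = (\<Sum>c\<in>insert b C. (t(b := s)) c *\<^sub>R c)"
        using insert.hyps st(1) by simp
      moreover have "\<forall>c\<in>insert b C. \<bar>(t(b := s)) c\<bar> \<le> M c"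
        using st(2,3) by simp
      ultimately show "y \<in> ?K (insert b C)" by blast
    qed
  qed
  moreover have "compact ((\<lambda>t. t *\<^sub>R b) ` {- M b..M b})"
    by (intro compact_continuous_image continuous_intros) auto
  ultimately show ?case
    using compact_sums[OF _ insert.IH] by simp
qed

text \<open>With respect to an orthogonal spanning set, Cauchy-Schwarz bounds the coefficient of
  each nonzero c by \<open>R / norm c\<close>.\<close>

lemma bounded_subset_compact_finite_span:
  fixes B S :: "'a::real_inner set"
  assumes B: "finite B" "span B = UNIV" and S: "bounded S"
  shows "\<exists>K. compact K \<and> S \<subseteq> K"
proof -
  from basis_orthogonal[OF B(1)] obtain C
    where "finite C \<and> card C \<le> card B \<and> span C = span B \<and> pairwise orthogonal C" ..
  then have C: "finite C" "span C = UNIV" "pairwise orthogonal C"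
    using B(2) by simp_all
  obtain R where R: "\<And>u. u \<in> S \<Longrightarrow> norm u \<le> R"
    using S by (auto simp: bounded_iff)
  have "u \<in> {\<Sum>c\<in>C. t c *\<^sub>R c | t. \<forall>c\<in>C. \<bar>t c\<bar> \<le> R / norm c}" if u: "u \<in> S" for u
  proof -
    have "u \<in> span C" using C(2) by simp
    then obtain t where t: "u = (\<Sum>c\<in>C. t c *\<^sub>R c)"
      using span_finite[OF C(1)] by auto
    \<comment> \<open>\<open>C\<close> may contain 0, whose coefficient is arbitrary. It is set to
      0, which meets the bound because \<open>R / norm 0\<close> is 0.\<close>
    define t' where "t' c = (if c = 0 then 0 else t c)" for c
    have "u = (\<Sum>c\<in>C. t' c *\<^sub>R c)"
      unfolding t t'_def by (intro sum.cong) auto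
    moreover have "\<bar>t' c\<bar> \<le> R / norm c" if c: "c \<in> C" for c
    proof (cases "c = 0")
      case False
      have "u \<bullet> c = (\<Sum>d\<in>C. t d * (d \<bullet> c))"
        by (simp add: t inner_sum_left)
      also have "\<dots> = (\<Sum>d\<in>C. if d = c then t c * (c \<bullet> c) else 0)"
        using C(3) c by (intro sum.cong) (auto simp: pairwise_def orthogonal_def)
      also have "\<dots> = t c * (norm c)\<^sup>2"
        using C(1) c by (simp add: power2_norm_eq_inner)
      finally have "\<bar>t c\<bar> * (norm c)\<^sup>2 = \<bar>u \<bullet> c\<bar>"
        by (simp add: abs_mult)
      also have "\<dots> \<le> R * norm c"
        using Cauchy_Schwarz_ineq2[of u c] R[OF u] by (meson mult_right_mono norm_ge_zero order_trans)
      finally show ?thesis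
        using False by (simp add: t'_def field_simps power2_eq_square)
    qed (simp add: t'_def)
    ultimately show ?thesis by blast
  qed
  then show ?thesis
    using compact_linear_combinations[OF C(1), of "\<lambda>c. R / norm c"] by blast
qed

text \<open>Olivier's theorem: the terms with indices from n div 2 to n - 1 are all at least
  \<open>a n\<close>, and there are at least n / 2 of them, so \<open>n * a n\<close> is at most
  twice a vanishing Cauchy block.\<close>

lemma summable_decseq_index_mult_tendsto_0:
  fixes a :: "nat \<Rightarrow> real"
  assumes dec: "decseq a" and a: "summable a"
  shows "(\<lambda>n. real n * a n) \<longlonglongrightarrow> 0"
proof (rule LIMSEQ_I)
  have nonneg: "a n \<ge> 0" for n
    using decseq_ge[OF dec summable_LIMSEQ_zero[OF a]] .
  fix e :: real assume "e > 0"
  then obtain N where N: "\<And>m n. m \<ge> N \<Longrightarrow> \<bar>sum a {m..<n}\<bar> < e / 2"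
    using a unfolding summable_Cauchy by (metis half_gt_zero real_norm_def)
  have "norm (real n * a n - 0) < e" if n: "n \<ge> 2 * N" for n
  proof -
    define m where "m = n div 2"
    have m: "m \<ge> N" "2 * m \<le> n" using n by (auto simp: m_def)
    have "real (n - m) * a n = (\<Sum>i\<in>{m..<n}. a n)" by simp
    also have "\<dots> \<le> sum a {m..<n}"
      by (intro sum_mono decseqD[OF dec]) auto
    also have "\<dots> < e / 2"
      using N[OF m(1), of n] by linarith
    finally have "2 * (real (n - m) * a n) < e" by simp
    moreover have "real n * a n \<le> (2 * real (n - m)) * a n"
      using m(2) nonneg by (intro mult_right_mono) (auto simp: of_nat_diff)
    ultimately show ?thesis using nonneg[of n] by (simp add: mult.assoc)
  qed
  then show "\<exists>N. \<forall>n\<ge>N. norm (real n * a n - 0) < e" by blast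
qed

section \<open>The iterates of the method\<close>

locale forward_backward_method = forward_backward f g
  for f g :: "'a::{real_inner, complete_space} \<Rightarrow> ereal" +
  fixes x0 s :: 'a and \<sigma> \<theta> \<delta> :: real and x :: "nat \<Rightarrow> 'a"
  assumes x0: "x0 \<in> edom g"
    and \<sigma>: "\<sigma> > 0" and \<theta>: "0 < \<theta>" "\<theta> < 1" and \<delta>: "0 < \<delta>" "\<delta> < 1/2"
    and x: "x = method1 f g \<sigma> \<theta> \<delta> x0"
    and s: "s \<in> minimizers (\<lambda>y. f y + g y)"
begin

definition step :: "nat \<Rightarrow> real" where
  "step k = linesearch1 f g (x k) \<sigma> \<theta> \<delta>"

text \<open>The forward-backward point for the last step size that the line search rejected; this
  reading is meaningful only if \<open>step k \<noteq> \<sigma>\<close>.\<close>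

definition trial :: "nat \<Rightarrow> 'a" where
  "trial k = fb_step f g (x k) (step k / \<theta>)"

definition gap :: "nat \<Rightarrow> real" where
  "gap k = obj (x k) - obj s"

lemma x_Suc: "x (Suc k) = fb_step f g (x k) (step k)"
  unfolding step_def by (simp add: x)

lemma x_dom: "x k \<in> edom g"
proof (induction k)
  case 0
  then show ?case by (simp add: x x0)
next
  case (Suc k)
  have "step k > 0"
    unfolding step_def by (rule linesearch1_spec(1)[OF Suc \<sigma> \<theta> \<delta>(1)])
  then show ?case unfolding x_Suc by (rule fb_step_in_dom)
qed

lemma step_pos: "step k > 0"
  unfolding step_def by (rule linesearch1_spec(1)[OF x_dom \<sigma> \<theta> \<delta>(1)])

lemma step_accepted:
  "step k * norm (grad f (x (Suc k)) - grad f (x k)) \<le> \<delta> * norm (x (Suc k) - x k)"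
  unfolding x_Suc unfolding step_def by (rule linesearch1_spec(2)[OF x_dom \<sigma> \<theta> \<delta>(1)])

lemma trial_rejected:
  "step k = \<sigma> \<or> \<delta> * norm (trial k - x k) < step k / \<theta> * norm (grad f (trial k) - grad f (x k))"
  unfolding trial_def unfolding step_def by (rule linesearch1_spec(3)[OF x_dom \<sigma> \<theta> \<delta>(1)])

lemma trial_dom: "trial k \<in> edom g"
  unfolding trial_def using step_pos \<theta> by (intro fb_step_in_dom) simp

text \<open>\<open>fb_step_scaling\<close> for the accepted step size and its predecessor: the
  factor \<open>1 / \<theta>\<close> ties the trial points to the increments of the
  iterates.\<close>

lemma norm_trial_le: "norm (x k - trial k) \<le> norm (x k - x (Suc k)) / \<theta>"
proof -
  have "step k \<le> step k / \<theta>"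
    using step_pos[of k] \<theta> by (simp add: field_simps)
  then have "step k * norm (x k - trial k) \<le> step k / \<theta> * norm (x k - x (Suc k))"
    unfolding trial_def x_Suc by (rule fb_step_scaling(2)[OF step_pos])
  also have "\<dots> = step k * (norm (x k - x (Suc k)) / \<theta>)" by simp
  finally show ?thesis by (rule mult_left_le_imp_le) (rule step_pos)
qed

section \<open>Minimizers, Fejer monotonicity and summability\<close>

lemma sum_ereal: "z \<in> edom g \<Longrightarrow> f z + g z = ereal (obj z)"
  using proper_fun_finite[OF f(1) dom_fg] proper_fun_finite[OF g(1)]
  by (metis plus_ereal.simps(1))

lemma minimizers_iff:
  "z \<in> minimizers (\<lambda>y. f y + g y) \<longleftrightarrow> z \<in> edom g \<and> (\<forall>u\<in>edom g. obj z \<le> obj u)"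
proof
  assume z: "z \<in> minimizers (\<lambda>y. f y + g y)"
  have le: "f z + g z \<le> f u + g u" for u
    using z by (simp add: minimizers_def is_arg_min_def not_less)
  have "f z + g z \<le> ereal (obj x0)"
    using le[of x0] sum_ereal[OF x0] by simp
  moreover have "f z \<noteq> -\<infinity>"
    using f(1) by (simp add: proper_fun_def)
  ultimately have z: "z \<in> edom g"
    by (cases "f z"; cases "g z") (auto simp: edom_def)
  moreover have "obj z \<le> obj u" if "u \<in> edom g" for u
    using le[of u] unfolding sum_ereal[OF z] sum_ereal[OF that] by simp
  ultimately show "z \<in> edom g \<and> (\<forall>u\<in>edom g. obj z \<le> obj u)" by blast
next
  assume z: "z \<in> edom g \<and> (\<forall>u\<in>edom g. obj z \<le> obj u)"
  have "f z + g z \<le> f u + g u" for u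
  proof (cases "u \<in> edom g")
    case True
    then show ?thesis
      using z sum_ereal[OF True] sum_ereal[of z] by simp
  next
    case False
    then have "g u = \<infinity>" by (simp add: edom_def)
    then show ?thesis using f(1) by (simp add: proper_fun_def)
  qed
  then show "z \<in> minimizers (\<lambda>y. f y + g y)"
    by (simp add: minimizers_def is_arg_min_def not_less)
qed

lemma s_dom: "s \<in> edom g" and s_le: "u \<in> edom g \<Longrightarrow> obj s \<le> obj u"
  using s minimizers_iff by blast+

lemma fejer:
  assumes "u \<in> edom g"
  shows "2 * step k * (obj (x (Suc k)) - obj u) + (1 - 2 * \<delta>) * (norm (x k - x (Suc k)))\<^sup>2
    \<le> (norm (x k - u))\<^sup>2 - (norm (x (Suc k) - u))\<^sup>2"
  unfolding x_Suc
  by (rule fb_step_fejer[OF x_dom assms step_pos]) (rule step_accepted[unfolded x_Suc])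

lemma gap_nonneg: "gap k \<ge> 0"
  using s_le[OF x_dom] by (simp add: gap_def)

text \<open>The Fejer inequality with u = \<open>x k\<close>, where the right-hand side is
  nonpositive.\<close>

lemma decseq_gap: "decseq gap"
proof (rule decseq_SucI)
  fix k
  have "0 \<le> (1 - 2 * \<delta>) * (norm (x k - x (Suc k)))\<^sup>2"
    using \<delta> by simp
  moreover have "2 * step k * (obj (x (Suc k)) - obj (x k))
      + (1 - 2 * \<delta>) * (norm (x k - x (Suc k)))\<^sup>2 \<le> 0 - (norm (x (Suc k) - x k))\<^sup>2"
    using fejer[OF x_dom[of k], of k] by simp
  ultimately have "2 * step k * (obj (x (Suc k)) - obj (x k)) \<le> 0"
    using zero_le_power2[of "norm (x (Suc k) - x k)"] by linarith
  then show "gap (Suc k) \<le> gap k"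
    using step_pos[of k] by (simp add: gap_def mult_le_0_iff)
qed

text \<open>Stated for every minimizer, since it is later applied to a cluster point of the iterates
  as well as to \<open>s\<close>.\<close>

lemma decseq_dist_minimizer:
  assumes u: "u \<in> minimizers (\<lambda>y. f y + g y)"
  shows "decseq (\<lambda>k. norm (x k - u))"
proof (rule decseq_SucI)
  fix k
  have uD: "u \<in> edom g" and le: "obj u \<le> obj (x (Suc k))"
    using u x_dom minimizers_iff by blast+
  have "0 \<le> 2 * step k * (obj (x (Suc k)) - obj u)"
    using step_pos[of k] le by simp
  moreover have "0 \<le> (1 - 2 * \<delta>) * (norm (x k - x (Suc k)))\<^sup>2"
    using \<delta> by simp
  ultimately have "(norm (x (Suc k) - u))\<^sup>2 \<le> (norm (x k - u))\<^sup>2"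
    using fejer[OF uD, of k] by linarith
  then show "norm (x (Suc k) - u) \<le> norm (x k - u)"
    by (rule power2_le_imp_le) simp
qed

text \<open>The Fejer inequality with u = \<open>s\<close> telescopes, and both left-hand terms are
  nonnegative.\<close>

lemma
  shows summable_step_gap: "summable (\<lambda>k. step k * gap (Suc k))"
    and summable_increments: "summable (\<lambda>k. (norm (x k - x (Suc k)))\<^sup>2)"
proof -
  define d where "d k = 2 * (step k * gap (Suc k)) + (1 - 2 * \<delta>) * (norm (x k - x (Suc k)))\<^sup>2" for k
  have nonneg: "0 \<le> step k * gap (Suc k)" "0 \<le> (1 - 2 * \<delta>) * (norm (x k - x (Suc k)))\<^sup>2" for k
    using step_pos[of k] gap_nonneg[of "Suc k"] \<delta> by auto
  have d_ge: "step k * gap (Suc k) \<le> d k" "(1 - 2 * \<delta>) * (norm (x k - x (Suc k)))\<^sup>2 \<le> d k" for k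
    using nonneg[of k] unfolding d_def by linarith+
  have "(\<Sum>k<n. d k) \<le> (norm (x 0 - s))\<^sup>2" for n
  proof -
    have "(\<Sum>k<n. d k) \<le> (\<Sum>k<n. (norm (x k - s))\<^sup>2 - (norm (x (Suc k) - s))\<^sup>2)"
      using fejer[OF s_dom] by (intro sum_mono) (simp add: d_def gap_def mult.assoc)
    also have "\<dots> = (norm (x 0 - s))\<^sup>2 - (norm (x n - s))\<^sup>2"
      by (rule sum_lessThan_telescope')
    finally show ?thesis using zero_le_power2[of "norm (x n - s)"] by linarith
  qed
  then have d: "summable d"
    using d_ge by (intro summableI_nonneg_bounded[where x = "(norm (x 0 - s))\<^sup>2"])
      (use nonneg order_trans in blast)
  show "summable (\<lambda>k. step k * gap (Suc k))"
    using nonneg d_ge by (intro summable_comparison_test'[OF d, of 0]) (simp only: real_norm_def abs_of_nonneg)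
  have "summable (\<lambda>k. (1 - 2 * \<delta>) * (norm (x k - x (Suc k)))\<^sup>2)"
    using nonneg d_ge by (intro summable_comparison_test'[OF d, of 0]) (simp only: real_norm_def abs_of_nonneg)
  then show "summable (\<lambda>k. (norm (x k - x (Suc k)))\<^sup>2)"
    using \<delta> by (simp add: summable_cmult_iff)
qed

lemma trial_diff_tendsto_0: "(\<lambda>k. x k - trial k) \<longlonglongrightarrow> 0"
proof (rule tendsto_norm_zero_cancel, rule tendsto_sandwich[OF _ _ tendsto_const])
  have "(\<lambda>k. norm (x k - x (Suc k))) \<longlonglongrightarrow> 0"
    using tendsto_real_sqrt[OF summable_LIMSEQ_zero[OF summable_increments]] by simp
  then show "(\<lambda>k. norm (x k - x (Suc k)) / \<theta>) \<longlonglongrightarrow> 0"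
    by (rule tendsto_divide_zero)
qed (auto simp: norm_trial_le)

section \<open>From lower bounds on the step sizes to the rate\<close>

lemma gap_smallo:
  assumes c: "c > 0" "\<forall>\<^sub>F k in sequentially. step k \<ge> c"
  shows "(\<lambda>k. real k * gap k) \<longlonglongrightarrow> 0"
proof (rule summable_decseq_index_mult_tendsto_0[OF decseq_gap])
  have "\<forall>\<^sub>F k in sequentially. norm (c * gap (Suc k)) \<le> step k * gap (Suc k)"
    using c(2)
  proof eventually_elim
    case (elim k)
    then show ?case
      using c(1) gap_nonneg[of "Suc k"] by (simp add: abs_mult mult_right_mono)
  qed
  then have "summable (\<lambda>k. c * gap (Suc k))"
    by (rule summable_comparison_test_ev[OF _ summable_step_gap])
  then show "summable gap"
    using c(1) by (simp add: summable_cmult_iff summable_Suc_iff)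
qed

lemma step_lower_bound:
  assumes L: "L-lipschitz_on B (grad f)" and B: "x k \<in> B" "trial k \<in> B"
  shows "min \<sigma> (\<delta> * \<theta> / (L + 1)) \<le> step k"
proof (cases "step k = \<sigma>")
  case False
  define n where "n = norm (trial k - x k)"
  have L0: "L \<ge> 0" using L by (rule lipschitz_on_nonneg)
  have "\<delta> * n < step k / \<theta> * norm (grad f (trial k) - grad f (x k))"
    using trial_rejected[of k] False by (simp add: n_def)
  also have "\<dots> \<le> step k / \<theta> * (L * n)"
    using lipschitz_onD[OF L B(2,1)] step_pos[of k] \<theta>
    by (intro mult_left_mono) (auto simp: dist_norm n_def)
  \<comment> \<open>\<open>L + 1\<close> keeps the later division valid when L = 0.\<close>
  also have "\<dots> \<le> step k / \<theta> * ((L + 1) * n)"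
    using step_pos[of k] \<theta> by (intro mult_left_mono mult_right_mono) (auto simp: n_def)
  finally have "\<delta> * n < (step k / \<theta> * (L + 1)) * n" by (simp only: mult.assoc)
  then have "\<delta> < step k / \<theta> * (L + 1)"
    by (rule mult_right_less_imp_less) (simp add: n_def)
  then have "\<delta> * \<theta> / (L + 1) < step k"
    using L0 \<theta> by (simp add: field_simps)
  then show ?thesis by simp
qed simp

lemma rate_of_lipschitz:
  assumes L: "L-lipschitz_on B (grad f)"
    and B: "\<forall>\<^sub>F k in sequentially. x k \<in> B \<and> trial k \<in> B"
  shows "(\<lambda>k. real k * gap k) \<longlonglongrightarrow> 0"
proof (rule gap_smallo)
  show "min \<sigma> (\<delta> * \<theta> / (L + 1)) > 0"
    using \<sigma> \<delta> \<theta> lipschitz_on_nonneg[OF L] by simp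
  show "\<forall>\<^sub>F k in sequentially. min \<sigma> (\<delta> * \<theta> / (L + 1)) \<le> step k"
    using B by eventually_elim (use step_lower_bound[OF L] in blast)
qed

section \<open>Convergence of the iterates\<close>

lemma norm_minimizer_le: "norm (x k - s) \<le> norm (x 0 - s)"
  using decseqD[OF decseq_dist_minimizer[OF s], of 0 k] by simp

lemma bounded_iterates: "bounded (range x \<union> range trial)"
proof -
  have "bounded (range x)"
  proof (rule boundedI)
    fix z assume "z \<in> range x"
    then obtain k where "z = x k" by blast
    then show "norm z \<le> norm (x 0 - s) + norm s"
      using norm_minimizer_le[of k] norm_triangle_sub[of z s] by simp
  qed
  moreover have "bounded (range (\<lambda>k. x k - trial k))"
    using trial_diff_tendsto_0 by (rule convergent_imp_bounded)
  ultimately have "bounded ((\<lambda>(u, v). u - v) ` (range x \<times> range (\<lambda>k. x k - trial k)))"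
    by (rule bounded_minus)
  moreover have "range trial \<subseteq> (\<lambda>(u, v). u - v) ` (range x \<times> range (\<lambda>k. x k - trial k))"
  proof
    fix z assume "z \<in> range trial"
    then obtain k where "z = (\<lambda>(u, v). u - v) (x k, x k - trial k)" by auto
    then show "z \<in> (\<lambda>(u, v). u - v) ` (range x \<times> range (\<lambda>k. x k - trial k))"
      by (rule image_eqI) blast
  qed
  ultimately have "bounded (range trial)" by (rule bounded_subset)
  with \<open>bounded (range x)\<close> show ?thesis by simp
qed

text \<open>If the step sizes tend to \<open>0\<close>, the rejection inequality shows that the trial points are
  asymptotically stationary. Otherwise some subsequence of them is bounded away from \<open>0\<close>, and
  summability together with monotonicity forces the gap of the iterates themselves to vanish.\<close>

lemma minimizing_companion:
  "\<exists>z. (\<forall>k. z k \<in> edom g) \<and> (\<lambda>k. x k - z k) \<longlonglongrightarrow> 0 \<and> (\<lambda>k. obj (z k)) \<longlonglongrightarrow> obj s"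
proof (cases "step \<longlonglongrightarrow> 0")
  case True
  define w where "w k = norm (grad f (trial k) - grad f (x k))" for k
  have diff: "(\<lambda>k. trial k - x k) \<longlonglongrightarrow> 0"
    using tendsto_minus[OF trial_diff_tendsto_0] by simp
  have "w \<longlonglongrightarrow> 0"
    unfolding w_def using x_dom trial_dom
    by (intro tendsto_norm_zero grad_tendsto[OF bounded_iterates _ _ _ diff]) auto
  obtain M where M: "\<And>k. norm (trial k) \<le> M"
    using bounded_iterates unfolding bounded_iff by blast
  \<comment> \<open>From here on the first alternative of \<open>trial_rejected\<close> is excluded,
    so the trial points really were rejected.\<close>
  have "\<forall>\<^sub>F k in sequentially. step k < \<sigma>"
    using True \<sigma> by (rule order_tendstoD)
  then have upper: "\<forall>\<^sub>F k in sequentially. obj (trial k) \<le> obj s + (w k / \<delta> + w k) * (norm s + M)"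
  proof eventually_elim
    case (elim k)
    define q where "q = step k / \<theta>"
    have q: "q > 0" using step_pos \<theta> by (simp add: q_def)
    have "\<delta> * norm (x k - trial k) < q * w k"
      using trial_rejected[of k] elim by (simp add: w_def q_def norm_minus_commute)
    then have "norm (x k - trial k) / q \<le> w k / \<delta>"
      using q \<delta>(1) by (simp add: field_simps)
    moreover have "norm (s - trial k) \<le> norm s + M"
      using norm_triangle_ineq4[of s "trial k"] M[of k] by linarith
    moreover have "0 \<le> w k / \<delta> + w k"
      using \<delta> by (simp add: w_def)
    ultimately have "(norm (x k - trial k) / q + w k) * norm (s - trial k)
        \<le> (w k / \<delta> + w k) * (norm s + M)"
      by (intro mult_mono) auto
    then show ?case
      using fb_step_obj_le[OF q s_dom, of "x k"]
      unfolding q_def trial_def[symmetric] w_def by linarith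
  qed
  have "(\<lambda>k. obj s + (w k / \<delta> + w k) * (norm s + M)) \<longlonglongrightarrow> obj s + (0 / \<delta> + 0) * (norm s + M)"
    using \<delta> by (intro tendsto_intros \<open>w \<longlonglongrightarrow> 0\<close>) simp
  then have lim: "(\<lambda>k. obj s + (w k / \<delta> + w k) * (norm s + M)) \<longlonglongrightarrow> obj s"
    by simp
  have "\<forall>\<^sub>F k in sequentially. obj s \<le> obj (trial k)"
    using s_le trial_dom by (intro always_eventually allI) blast
  then have "(\<lambda>k. obj (trial k)) \<longlonglongrightarrow> obj s"
    by (rule tendsto_sandwich[OF _ upper tendsto_const lim])
  then show ?thesis using trial_dom trial_diff_tendsto_0 by blast
next
  case False
  then obtain c where c: "c > 0" "\<exists>\<^sub>F k in sequentially. step k \<ge> c"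
    using step_pos by (auto simp: tendsto_iff not_eventually not_less less_imp_le)
  have "gap \<longlonglongrightarrow> 0"
  proof (rule LIMSEQ_I)
    fix e :: real assume e: "e > 0"
    have "\<forall>\<^sub>F k in sequentially. step k * gap (Suc k) < c * e"
      using summable_LIMSEQ_zero[OF summable_step_gap] c e by (intro order_tendstoD) auto
    with c(2) have "\<exists>\<^sub>F k in sequentially. step k * gap (Suc k) < c * e \<and> step k \<ge> c"
      by (rule frequently_eventually_conj)
    then obtain k where k: "step k \<ge> c" "step k * gap (Suc k) < c * e"
      using frequently_ex by blast
    have "c * gap (Suc k) \<le> step k * gap (Suc k)"
      using k(1) gap_nonneg by (rule mult_right_mono)
    with k(2) c have "gap (Suc k) < e"
      by (meson le_less_trans mult_less_cancel_left_pos)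
    then have "norm (gap n - 0) < e" if "n \<ge> Suc k" for n
      using decseqD[OF decseq_gap that] gap_nonneg[of n] by simp
    then show "\<exists>N. \<forall>n\<ge>N. norm (gap n - 0) < e" by blast
  qed
  then have "(\<lambda>k. obj (x k)) \<longlonglongrightarrow> obj s"
    unfolding gap_def by (rule LIM_zero_cancel)
  moreover have "(\<lambda>k. x k - x k) \<longlonglongrightarrow> 0" by simp
  ultimately show ?thesis using x_dom by blast
qed

text \<open>Compactness gives a cluster point, shared with the companion sequence, whose values tend
  to the minimum; lower semicontinuity makes it a minimizer. Monotone distances to it then upgrade
  subsequential convergence to convergence.\<close>

lemma convergent_to_minimizer:
  assumes B: "finite B" "span B = (UNIV :: 'a set)"
  shows "\<exists>l\<in>minimizers (\<lambda>y. f y + g y). x \<longlonglongrightarrow> l"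
proof -
  obtain K where K: "compact K" "range x \<union> range trial \<subseteq> K"
    using bounded_subset_compact_finite_span[OF B bounded_iterates] by blast
  then have "\<forall>k. x k \<in> K" by blast
  then obtain l r where r: "strict_mono r" "(x \<circ> r) \<longlonglongrightarrow> l"
    using K(1) unfolding compact_def by meson
  obtain z where z: "\<And>k. z k \<in> edom g" "(\<lambda>k. x k - z k) \<longlonglongrightarrow> 0" "(\<lambda>k. obj (z k)) \<longlonglongrightarrow> obj s"
    using minimizing_companion by blast
  have "(\<lambda>k. x (r k) - (x (r k) - z (r k))) \<longlonglongrightarrow> l - 0"
    using r(2) LIMSEQ_subseq_LIMSEQ[OF z(2) r(1)] by (intro tendsto_diff) (auto simp: o_def)
  then have zl: "(\<lambda>k. z (r k)) \<longlonglongrightarrow> l" by simp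
  have "(\<lambda>k. obj (z (r k))) \<longlonglongrightarrow> obj s"
    using LIMSEQ_subseq_LIMSEQ[OF z(3) r(1)] by (simp add: o_def)
  then have "f l + g l \<le> ereal (obj s)"
    using z(1) by (intro lsc_fun_le_limit[OF lsc_fun_add[OF f(2) g(2) f(1) g(1)] zl]) (auto simp: sum_ereal)
  then have le: "f l + g l \<le> f s + g s"
    using sum_ereal[OF s_dom] by simp
  have "f s + g s \<le> f u + g u" for u
    using s by (simp add: minimizers_def is_arg_min_def not_less)
  with le have l: "l \<in> minimizers (\<lambda>y. f y + g y)"
    unfolding minimizers_def is_arg_min_def by (auto simp: not_less intro: order_trans)
  have "x \<longlonglongrightarrow> l"
  proof (rule metric_LIMSEQ_I)
    fix e :: real assume "e > 0"
    then obtain j where "dist (x (r j)) l < e"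
      using metric_LIMSEQ_D[OF r(2)] by force
    then have "dist (x k) l < e" if "k \<ge> r j" for k
      using decseqD[OF decseq_dist_minimizer[OF l] that] by (simp add: dist_norm)
    then show "\<exists>N. \<forall>k\<ge>N. dist (x k) l < e" by blast
  qed
  with l show ?thesis by blast
qed

section \<open>Rates for the objective gap\<close>

lemma objective_gap_eq: "objective_gap (\<lambda>y. f y + g y) (x k) = gap k"
proof -
  have "(INF y. f y + g y) = f s + g s"
    using s by (intro antisym INF_lower INF_greatest)
      (auto simp: minimizers_def is_arg_min_def not_less)
  then show ?thesis
    by (simp add: objective_gap_def gap_def sum_ereal x_dom s_dom)
qed

lemma objective_gap_smallo:
  assumes "(\<lambda>k. real k * gap k) \<longlonglongrightarrow> 0"
  shows "(\<lambda>k. objective_gap (\<lambda>y. f y + g y) (x k)) \<in> o(\<lambda>k. 1 / real k)"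
proof (rule smalloI_tendsto)
  show "(\<lambda>k. objective_gap (\<lambda>y. f y + g y) (x k) / (1 / real k)) \<longlonglongrightarrow> 0"
    using assms by (simp add: objective_gap_eq mult.commute)
  \<comment> \<open>At index 0 the comparison function has the value 1 / 0 = 0.\<close>
  show "\<forall>\<^sub>F k in sequentially. 1 / real k \<noteq> 0"
    using eventually_gt_at_top[of 0] by eventually_elim simp
qed

lemma rate_global_lipschitz:
  assumes "L-lipschitz_on (edom g) (grad f)"
  shows "(\<lambda>k. objective_gap (\<lambda>y. f y + g y) (x k)) \<in> o(\<lambda>k. 1 / real k)"
  using x_dom trial_dom by (intro objective_gap_smallo rate_of_lipschitz[OF assms]) simp

lemma rate_local_lipschitz:
  assumes B: "finite B" "span B = (UNIV :: 'a set)"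
    and lip: "locally_lipschitz_near (grad f) (minimizers (\<lambda>y. f y + g y))"
  shows "(\<lambda>k. objective_gap (\<lambda>y. f y + g y) (x k)) \<in> o(\<lambda>k. 1 / real k)"
proof -
  obtain l where l: "l \<in> minimizers (\<lambda>y. f y + g y)" "x \<longlonglongrightarrow> l"
    using convergent_to_minimizer[OF B] by blast
  obtain e L where e: "e > 0" and L: "L-lipschitz_on (cball l e) (grad f)"
    using lip l(1) unfolding locally_lipschitz_near_def by blast
  \<comment> \<open>The Lipschitz ball around \<open>l\<close> must capture the rejected points as
    well as the iterates.\<close>
  have "trial \<longlonglongrightarrow> l"
    using tendsto_diff[OF l(2) trial_diff_tendsto_0] by simp
  then have "\<forall>\<^sub>F k in sequentially. dist (trial k) l < e"
    using e by (rule tendstoD)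
  with tendstoD[OF l(2) e] have "\<forall>\<^sub>F k in sequentially. x k \<in> cball l e \<and> trial k \<in> cball l e"
    by eventually_elim (simp add: dist_commute)
  then show ?thesis by (intro objective_gap_smallo rate_of_lipschitz[OF L])
qed

end

theorem corollary4p5:
  fixes f g :: "'a::{real_inner, complete_space} \<Rightarrow> ereal"
    and x0 :: 'a and \<sigma> \<theta> \<delta> :: real and x :: "nat \<Rightarrow> 'a"
  assumes A1: "assumption_A1 f g"
    and A2: "assumption_A2 f g"
    and x0: "x0 \<in> edom g"
    and sigma: "\<sigma> > 0"
    and theta: "0 < \<theta>" "\<theta> < 1"
    and delta: "0 < \<delta>" "\<delta> < 1/2"
    and x: "x = method1 f g \<sigma> \<theta> \<delta> x0"
    and nonempty: "minimizers (\<lambda>y. f y + g y) \<noteq> {}"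
  shows "((\<exists>L. L-lipschitz_on (edom g) (grad f)) \<longrightarrow>
            (\<lambda>k. objective_gap (\<lambda>y. f y + g y) (x k)) \<in> O(\<lambda>k. 1 / real k))
       \<and> ((\<exists>B :: 'a set. finite B \<and> span B = UNIV) \<and>
            locally_lipschitz_near (grad f) (minimizers (\<lambda>y. f y + g y)) \<longrightarrow>
            (\<lambda>k. objective_gap (\<lambda>y. f y + g y) (x k)) \<in> o(\<lambda>k. 1 / real k))"
proof -
  obtain s where "s \<in> minimizers (\<lambda>y. f y + g y)"
    using nonempty by blast
  then interpret forward_backward_method f g x0 s \<sigma> \<theta> \<delta> x
    by unfold_locales (use assms in auto)
  \<comment> \<open>For part (i) the little-o bound is weakened to big-O.\<close>
  show ?thesis
    using rate_global_lipschitz rate_local_lipschitz landau_o.small_imp_big by blast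
qed

end
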